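(* Let $q\ge 2$, let $M\in\mathbb{R}^{q\times q}$ be symmetric positive definite, $\|y\|_M=\sqrt{y^\top My}$, and $T=M^{1/2}$. Let $(A_k)_{k\ge 0}$ be the sequence of outer approximations of the compact slice $A=P\cap S(\gamma)$ generated by the norm-minimization-based outer approximation algorithm described in the context, where the scalarizations and the Hausdorff distance are based on $\|\cdot\|_M$. Then, with $\tilde A:=T(A)=TP\cap T(S(\gamma))$: (i) For every $\varepsilon>0$ there exists $K\in\mathbb{N}$ such that for all $k\ge K$, $$\delta_H(A_k,A;\|\cdot\|_M)\ \le\ (1+\varepsilon)\,\bar\lambda(\tilde A)\,k^{\frac{2}{1-q}}.$$ (ii) In particular, $\delta_H(A_k,A;\|\cdot\|_M)=O\bigl(k^{\frac{2}{1-q}}\bigr)$ as $k\to\infty$.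
   Context: Problem setting. $C\subset\mathbb{R}^q$ is a closed convex cone that is solid (nonempty interior), pointed ($C\cap(-C)=\{0\}$), nontrivial and polyhedral; $C^+=\{w\in\mathbb{R}^q: w^\top y\ge 0\ \forall y\in C\}$ is its dual cone, and $y\le_C z$ means $z-y\in C$. $X\subset\mathbb{R}^n$ is nonempty, compact, convex with nonempty interior. $\Gamma:X\to\mathbb{R}^q$ is continuous and $C$-convex: $\Gamma(\lambda x_1+(1-\lambda)x_2)\le_C\lambda\Gamma(x_1)+(1-\lambda)\Gamma(x_2)$ for all $x_1,x_2\in X$, $\lambda\in[0,1]$. The upper image is $P=\Gamma(X)+C$. Fix $\bar w\in\operatorname{int}C^+$ and $\gamma=\sup_{x\in X}\bar w^\top\Gamma(x)+\alpha$ with $\alpha>0$ large enough that $\Gamma(X)\subset\operatorname{int}S(\gamma)$, where $S(\gamma)=\{y\in\mathbb{R}^q:\bar w^\top y\le\gamma\}$. The slice $A=P\cap S(\gamma)$ is nonempty, convex and compact. Scalarization. For $v\in\mathbb{R}^q$, problem $(P_M(v))$ is: minimize $\|z\|_M$ over $x\in X$, $z\in\mathbb{R}^q$ subject to $\Gamma(x)-z-v\le_C 0$ and $\bar w^\top(v+z)\le\gamma$. Its Lagrange dual $(D_M(v))$ is: maximize over $w\in C^+$, $\lambda\ge 0$ the value $\inf_{x\in X,z\in\mathbb{R}^q}\bigl(\|z\|_M+w^\top(\Gamma(x)-z-v)+\lambda(\bar w^\top(v+z)-\gamma)\bigr)$. Algorithm. For $w\neq0$ put $h_A(w)=\inf_{y\in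 A}w^\top y$ and $\mathcal H(w,A)=\{y: w^\top y\ge h_A(w)\}$. Let $\omega_1,\dots,\omega_I\in C^+\setminus\{0\}$ be generators of $C^+$ and set $A_0=\bigl(\bigcap_{j=1}^I\mathcal H(\omega_j,A)\bigr)\cap S(\gamma)$. At iteration $k\ge0$: for each vertex $v\in\operatorname{ext}(A_k)$ let $(x^v,z^v)$ be an optimal solution of $(P_M(v))$; choose $v_k\in\arg\max_{v\in\operatorname{ext}(A_k)}\|z^v\|_M$; let $(w_k,\lambda_k)$ be an optimal solution of $(D_M(v_k))$, $z_k=z^{v_k}$, $y_k=v_k+z_k$, $a_k=w_k-\lambda_k\bar w$; set $A_{k+1}=A_k\cap\{y:a_k^\top y\ge a_k^\top y_k\}$. If $z_k=0$ (so that $A_k=A$) the algorithm stops and one sets $A_j=A$ for $j\ge k$. No positive stopping tolerance is used. Notation. For nonempty $B,D\subset\mathbb{R}^q$, $\delta_H(B,D;\|\cdot\|)=\max\{\sup_{y\in B}\inf_{z\in D}\|y-z\|,\ \sup_{z\in D}\inf_{y\in B}\|y-z\|\}$. For a convex compact set $B$, $R(B)$ is the radius of the smallest Euclidean ball containing $B$; $\pi_q$ is the volume of the Euclidean unit ball in $\mathbb{R}^q$; and $$\bar\lambda(B)=16\,R(B)\left(\frac{q\,\pi_q}{\pi_{q-1}}\right)^{\frac{2}{q-1}}.$$ *)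

theory Defs
  imports "HOL-Analysis.Analysis" "HOL-Library.Landau_Symbols"
begin

subsection \<open>Matrices and norms\<close>

definition sym_pos_def :: "real^'q^'q \<Rightarrow> bool" where
  "sym_pos_def M \<longleftrightarrow> transpose M = M \<and> (\<forall>y. y \<noteq> 0 \<longrightarrow> 0 < y \<bullet> (M *v y))"

text \<open>The principal square root; it is well defined whenever \<open>M\<close> is symmetric positive definite.\<close>

definition matrix_sqrt :: "real^'q^'q \<Rightarrow> real^'q^'q" where
  "matrix_sqrt M = (THE T. sym_pos_def T \<and> T ** T = M)"

definition mnorm :: "real^'q^'q \<Rightarrow> real^'q \<Rightarrow> real" where
  "mnorm M y = sqrt (y \<bullet> (M *v y))"

text \<open>The Hausdorff distance with respect to a norm \<open>N\<close>. Suprema and infima are taken in the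
  reals, so this is meaningful for nonempty bounded sets.\<close>

definition hausdorff :: "('a::real_vector \<Rightarrow> real) \<Rightarrow> 'a set \<Rightarrow> 'a set \<Rightarrow> real" where
  "hausdorff N B D = max (SUP y\<in>B. INF z\<in>D. N (y - z)) (SUP z\<in>D. INF y\<in>B. N (y - z))"

text \<open>The radius of the smallest enclosing Euclidean ball. For nonempty bounded \<open>B\<close> in Euclidean
  space the infimum is attained.\<close>

definition circumradius :: "'a::euclidean_space set \<Rightarrow> real" where
  "circumradius B = Inf {r. 0 \<le> r \<and> (\<exists>c. B \<subseteq> cball c r)}"

definition lambda_bar :: "(real^'q) set \<Rightarrow> real" where
  "lambda_bar B =
     16 * circumradius B *
       (real CARD('q) * unit_ball_vol (real CARD('q)) / unit_ball_vol (real CARD('q) - 1))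
         powr (2 / (real CARD('q) - 1))"

subsection \<open>The convex vector optimization problem\<close>

definition dual_cone :: "'a::real_inner set \<Rightarrow> 'a set" where
  "dual_cone C = {w. \<forall>y\<in>C. 0 \<le> w \<bullet> y}"

definition cone_le :: "'a::real_vector set \<Rightarrow> 'a \<Rightarrow> 'a \<Rightarrow> bool" where
  "cone_le C y z \<longleftrightarrow> z - y \<in> C"

definition ordering_cone :: "'a::euclidean_space set \<Rightarrow> bool" where
  "ordering_cone C \<longleftrightarrow>
     closed C \<and> convex C \<and> cone C \<and> polyhedron C \<and>
     interior C \<noteq> {} \<and> C \<inter> uminus ` C = {0} \<and> C \<noteq> {0} \<and> C \<noteq> UNIV"

definition cone_convex_on ::
    "'b::real_vector set \<Rightarrow> 'a::real_vector set \<Rightarrow> ('a \<Rightarrow> 'b) \<Rightarrow> bool" where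
  "cone_convex_on C X \<Gamma> \<longleftrightarrow>
     (\<forall>x1\<in>X. \<forall>x2\<in>X. \<forall>t\<in>{0..1}.
        cone_le C (\<Gamma> (t *\<^sub>R x1 + (1 - t) *\<^sub>R x2)) (t *\<^sub>R \<Gamma> x1 + (1 - t) *\<^sub>R \<Gamma> x2))"

definition upper_image :: "'b::real_vector set \<Rightarrow> 'a set \<Rightarrow> ('a \<Rightarrow> 'b) \<Rightarrow> 'b set" where
  "upper_image C X \<Gamma> = {\<Gamma> x + c | x c. x \<in> X \<and> c \<in> C}"

definition lower_halfspace :: "'a::real_inner \<Rightarrow> real \<Rightarrow> 'a set" where
  "lower_halfspace wbar \<gamma> = {y. wbar \<bullet> y \<le> \<gamma>}"

subsection \<open>Scalarization\<close>

definition primal_feasible ::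
    "(real^'q) set \<Rightarrow> (real^'n) set \<Rightarrow> (real^'n \<Rightarrow> real^'q) \<Rightarrow> real^'q \<Rightarrow> real \<Rightarrow>
     real^'q \<Rightarrow> (real^'n) \<times> (real^'q) \<Rightarrow> bool" where
  "primal_feasible C X \<Gamma> wbar \<gamma> v = (\<lambda>(x, z).
     x \<in> X \<and> cone_le C (\<Gamma> x - z - v) 0 \<and> wbar \<bullet> (v + z) \<le> \<gamma>)"

definition primal_optimal ::
    "real^'q^'q \<Rightarrow> (real^'q) set \<Rightarrow> (real^'n) set \<Rightarrow> (real^'n \<Rightarrow> real^'q) \<Rightarrow> real^'q \<Rightarrow> real \<Rightarrow>
     real^'q \<Rightarrow> (real^'n) \<times> (real^'q) \<Rightarrow> bool" where
  "primal_optimal M C X \<Gamma> wbar \<gamma> v =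
     is_arg_min (\<lambda>(x, z). mnorm M z) (primal_feasible C X \<Gamma> wbar \<gamma> v)"

text \<open>The infimum may be \<open>-\<infinity>\<close>, hence the extended reals.\<close>

definition dual_value ::
    "real^'q^'q \<Rightarrow> (real^'n) set \<Rightarrow> (real^'n \<Rightarrow> real^'q) \<Rightarrow> real^'q \<Rightarrow> real \<Rightarrow>
     real^'q \<Rightarrow> (real^'q) \<times> real \<Rightarrow> ereal" where
  "dual_value M X \<Gamma> wbar \<gamma> v = (\<lambda>(w, l).
     INF (x, z) \<in> X \<times> UNIV.
       ereal (mnorm M z + w \<bullet> (\<Gamma> x - z - v) + l * (wbar \<bullet> (v + z) - \<gamma>)))"

definition dual_optimal ::
    "real^'q^'q \<Rightarrow> (real^'q) set \<Rightarrow> (real^'n) set \<Rightarrow> (real^'n \<Rightarrow> real^'q) \<Rightarrow> real^'q \<Rightarrow> real \<Rightarrow>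
     real^'q \<Rightarrow> (real^'q) \<times> real \<Rightarrow> bool" where
  "dual_optimal M C X \<Gamma> wbar \<gamma> v =
     is_arg_max (dual_value M X \<Gamma> wbar \<gamma> v) (\<lambda>(w, l). w \<in> dual_cone C \<and> 0 \<le> l)"

subsection \<open>The outer approximation algorithm\<close>

definition supporting_halfspace :: "'a::real_inner \<Rightarrow> 'a set \<Rightarrow> 'a set" where
  "supporting_halfspace w A = {y. w \<bullet> y \<ge> (INF a\<in>A. w \<bullet> a)}"

definition initial_approx ::
    "(nat \<Rightarrow> 'a::real_inner) \<Rightarrow> nat \<Rightarrow> 'a set \<Rightarrow> 'a \<Rightarrow> real \<Rightarrow> 'a set" where
  "initial_approx \<omega> I A wbar \<gamma> =
     (\<Inter>j\<in>{1..I}. supporting_halfspace (\<omega> j) A) \<inter> lower_halfspace wbar \<gamma>"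

text \<open>\<open>outer_approx_run\<close> says that \<open>Ak\<close> is the sequence of sets produced by some run of the
  algorithm: \<open>sol k v\<close> is the solution \<open>(x, z)\<close> of the primal scalarization chosen for the vertex
  \<open>v\<close> in iteration \<open>k\<close>, \<open>vs k\<close> is the selected vertex and \<open>ws k\<close>, \<open>ls k\<close> form the chosen dual
  solution. Iteration \<open>k\<close> takes place iff no earlier iteration stopped; data with an index
  after the stopping iteration are unconstrained, except that \<open>Ak j\<close> is then \<open>A\<close>. In the stopping
  iteration \<open>Ak k = A\<close> already holds, so it is not imposed.\<close>

definition outer_approx_run ::
    "real^'q^'q \<Rightarrow> (real^'q) set \<Rightarrow> (real^'n) set \<Rightarrow> (real^'n \<Rightarrow> real^'q) \<Rightarrow> real^'q \<Rightarrow> real \<Rightarrow>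
     (nat \<Rightarrow> real^'q) \<Rightarrow> nat \<Rightarrow> (real^'q) set \<Rightarrow>
     (nat \<Rightarrow> (real^'q) set) \<Rightarrow> (nat \<Rightarrow> real^'q \<Rightarrow> (real^'n) \<times> (real^'q)) \<Rightarrow>
     (nat \<Rightarrow> real^'q) \<Rightarrow> (nat \<Rightarrow> real^'q) \<Rightarrow> (nat \<Rightarrow> real) \<Rightarrow> bool" where
  "outer_approx_run M C X \<Gamma> wbar \<gamma> \<omega> I A Ak sol vs ws ls \<longleftrightarrow>
     Ak 0 = initial_approx \<omega> I A wbar \<gamma> \<and>
     (\<forall>k. (\<forall>i<k. snd (sol i (vs i)) \<noteq> 0) \<longrightarrow>
        (\<forall>v. v extreme_point_of Ak k \<longrightarrow> primal_optimal M C X \<Gamma> wbar \<gamma> v (sol k v)) \<and>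
        is_arg_max (\<lambda>v. mnorm M (snd (sol k v))) (\<lambda>v. v extreme_point_of Ak k) (vs k) \<and>
        (let z = snd (sol k (vs k)); y = vs k + z; a = ws k - ls k *\<^sub>R wbar in
           if z = 0 then \<forall>j>k. Ak j = A
           else dual_optimal M C X \<Gamma> wbar \<gamma> (vs k) (ws k, ls k) \<and>
                Ak (Suc k) = Ak k \<inter> {u. a \<bullet> u \<ge> a \<bullet> y}))"

end

(*
The dual solution of the scalarization at a vertex v is forced: its normal w - lambda wbar is the
gradient of the norm at z, so after applying T = M^(1/2) every cut is the supporting half-space of
T(A) at the Euclidean projection p of T(v). Let u be the outward unit normal and delta the distance
at such a step. If step i precedes step j, then v_j satisfies the cut of step i, which gives
(p_i - p_j) . (u_i - u_j) >= delta_j (u_i . u_j). Hence the points p + t u with t >= r are pairwise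
at distance at least sqrt (2 r delta) when delta <= r. With r slightly larger than the circumradius
of T(A), choose t such that they lie on one sphere of radius 2 r. Comparing the volume of disjoint
balls around them with that of a thin shell bounds their number, and the resulting constant is
compared with the one of lambda_bar through 2 pi_(q-1) <= 2^((q-1)/2) pi_q.
*)
theory Submission
  imports Defs
begin

subsection \<open>Sphere packings and the cutting scheme\<close>

text \<open>Neither the projections p nor the normals u have to be far apart: along a flat part of
  T(A) the normals may agree, at a corner the projections may. Pushing p outward along u by at least
  r records both. In the expanded squared distance the cut contributes at least 2 r delta (u_i .
  u_j) and the angle between the normals at least 2 r delta (1 - u_i . u_j), so the angle drops out
  of the sum.

  A common sphere makes the count (q-1)-dimensional: the shell is about as thick as the separation,
  so one power of it cancels. Put tau = sqrt (2 r delta) / (4 r), the packing radius relative to the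
  sphere radius 2 r. The count reads (k+1) tau^(q-1) <= 2 q (1+tau)^(q-1), and delta = 8 r tau^2,
  which gives about 8 r (2q/k)^(2/(q-1)). The comparison of unit-ball volumes replaces 2q by
  2^((q-1)/2) q pi_q / pi_(q-1), and the root of the power of 2 turns 8 r into 16 r. The factor 1 +
  epsilon absorbs (1+tau)^2 and the excess of r over the circumradius.\<close>

lemma unit_ball_vol_add_2:
  assumes "n \<ge> 0"
  shows "unit_ball_vol (n + 2) = 2 * pi / (n + 2) * unit_ball_vol n"
proof -
  have "Gamma ((n + 2) / 2 + 1) = (n / 2 + 1) * Gamma (n / 2 + 1)"
    using Gamma_plus1[of "n / 2 + 1"] assms
    by (auto simp: add_divide_distrib nonpos_Ints_def)
  moreover have "pi powr ((n + 2) / 2) = pi * pi powr (n / 2)"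
    by (simp add: add_divide_distrib powr_add)
  ultimately have "unit_ball_vol (n + 2) = (pi * pi powr (n / 2)) / ((n / 2 + 1) * Gamma (n / 2 + 1))"
    by (simp only: unit_ball_vol_def)
  also have "\<dots> = 2 * pi / (n + 2) * (pi powr (n / 2) / Gamma (n / 2 + 1))"
  proof -
    have "n / 2 + 1 = (n + 2) / 2" by simp
    then show ?thesis by (simp only: times_divide_times_eq) (simp add: mult_ac)
  qed
  finally show ?thesis
    by (simp only: unit_ball_vol_def)
qed

text \<open>The comparison 2 pi_n <= 2^(n/2) pi_(n+1), squared so that no half-integer power of 2
  occurs. The recursion for the volumes moves n by two, so parity forces two base cases; the
  inductive step only needs (m+3)/(m+2) <= 2.\<close>

lemma unit_ball_vol_ratio:
  assumes "n \<ge> 1"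
  shows "4 * (unit_ball_vol (real n))\<^sup>2 \<le> 2 ^ n * (unit_ball_vol (real n + 1))\<^sup>2"
  using assms
proof (induction n rule: less_induct)
  case (less n)
  \<comment> \<open>From sin x <= x at x = pi/6. The case n = 1 reads 16 <= 2 pi^2, for which 3 is a
    good enough lower bound.\<close>
  have "pi \<ge> 3"
    using sin_x_le_x[of "pi / 6"] by (simp add: sin_30)
  then have pi2: "pi\<^sup>2 \<ge> 9"
    using power_mono[of 3 pi 2] by simp
  consider "n = 1" | "n = 2" | m where "n = m + 2" "m \<ge> 1"
    using less.prems by (metis One_nat_def Suc_1 Suc_leI add_2_eq_Suc' le_antisym le_zero_eq not0_implies_Suc not_less_eq_eq)
  then show ?case
  proof cases
    case 1
    then show ?thesis using pi2 by (simp add: unit_ball_vol_2)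
  next
    case 2
    then show ?thesis by (simp add: unit_ball_vol_2 unit_ball_vol_3 power_mult_distrib power_divide)
  next
    case 3
    define a b where "a = unit_ball_vol (real m)" and "b = unit_ball_vol (real m + 1)"
    have IH: "4 * a\<^sup>2 \<le> 2 ^ m * b\<^sup>2"
      using less.IH[of m] 3 by (simp add: a_def b_def)
    have "2 * pi / (real m + 2) \<le> 2 * (2 * pi / (real m + 3))"
      by (simp add: divide_simps)
    then have c: "(2 * pi / (real m + 2))\<^sup>2 \<le> 4 * (2 * pi / (real m + 3))\<^sup>2"
      using power_mono[of "2 * pi / (real m + 2)" "2 * (2 * pi / (real m + 3))" 2]
      unfolding power_mult_distrib[of 2] by simp
    have "4 * (unit_ball_vol (real n))\<^sup>2 = (2 * pi / (real m + 2))\<^sup>2 * (4 * a\<^sup>2)"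
      using unit_ball_vol_add_2[of "real m"] 3 by (simp add: a_def power_mult_distrib power_divide add_ac)
    also have "\<dots> \<le> (4 * (2 * pi / (real m + 3))\<^sup>2) * (2 ^ m * b\<^sup>2)"
      using c IH by (rule mult_mono) auto
    also have "\<dots> = 2 ^ n * (unit_ball_vol (real n + 1))\<^sup>2"
      using unit_ball_vol_add_2[of "real m + 1"] 3 by (simp add: b_def power_mult_distrib power_divide power_add add_ac)
    finally show ?thesis .
  qed
qed

lemma power_diff_le_mult:
  fixes a b :: real
  assumes "0 \<le> b" "b \<le> a"
  shows "a ^ n - b ^ n \<le> real n * (a - b) * a ^ (n - 1)"
proof (induction n)
  case (Suc n)
  have 1: "b * (a ^ n - b ^ n) \<le> a * (real n * (a - b) * a ^ (n - 1))"
  proof -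
    have "b ^ n \<le> a ^ n" using assms by (intro power_mono)
    then have "b * (a ^ n - b ^ n) \<le> a * (a ^ n - b ^ n)"
      using assms by (intro mult_right_mono) auto
    also have "\<dots> \<le> a * (real n * (a - b) * a ^ (n - 1))"
      using Suc assms by (intro mult_left_mono) auto
    finally show ?thesis .
  qed
  have "a ^ Suc n - b ^ Suc n = (a - b) * a ^ n + b * (a ^ n - b ^ n)"
    by (simp add: algebra_simps)
  also have "\<dots> \<le> (a - b) * a ^ n + real n * (a - b) * a ^ n"
    using 1 by (cases n) (auto simp: algebra_simps)
  finally show ?case by (simp add: algebra_simps)
qed auto

text \<open>The balls of radius d/2 around the points are disjoint from each other and from the
  concentric ball of radius R - d/2, and all lie in the ball of radius R + d/2; the common factor
  \<open>unit_ball_vol\<close> cancels. The hypothesis d <= 2 R keeps the inner radius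
  nonnegative.\<close>

lemma sphere_packing_bound:
  fixes x :: "'b \<Rightarrow> 'a::euclidean_space"
  assumes "finite J" "0 < d" "d \<le> 2 * R"
    and sph: "\<And>j. j \<in> J \<Longrightarrow> dist c (x j) = R"
    and sep: "\<And>i j. i \<in> J \<Longrightarrow> j \<in> J \<Longrightarrow> i \<noteq> j \<Longrightarrow> d \<le> dist (x i) (x j)"
  shows "real (card J) * (d / 2) ^ DIM('a) \<le> (R + d / 2) ^ DIM('a) - (R - d / 2) ^ DIM('a)"
proof -
  let ?n = "DIM('a)" and ?V = "unit_ball_vol (real DIM('a))"
  let ?B = "\<lambda>j. ball (x j) (d / 2)"
  have disj: "disjoint_family_on ?B J"
    unfolding disjoint_family_on_def
  proof (intro ballI impI)
    fix i j assume ij: "i \<in> J" "j \<in> J" "i \<noteq> j"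
    show "?B i \<inter> ?B j = {}"
      using sep[OF ij] by (metis disjoint_ballI field_sum_of_halves)
  qed
  have sub: "(\<Union>j\<in>J. ?B j) \<union> ball c (R - d / 2) \<subseteq> ball c (R + d / 2)"
  proof -
    have "y \<in> ball c (R + d / 2)" if "j \<in> J" "y \<in> ?B j" for j y
      using that sph[of j] dist_triangle[of c y "x j"] by simp
    then show ?thesis using assms by auto
  qed
  have empty: "(\<Union>j\<in>J. ?B j) \<inter> ball c (R - d / 2) = {}"
  proof -
    have "False" if "j \<in> J" "y \<in> ?B j" "y \<in> ball c (R - d / 2)" for j y
      using that sph[of j] dist_triangle[of c "x j" y] by (simp add: dist_commute)
    then show ?thesis by blast
  qed
  have ball: "ball a s \<in> fmeasurable lborel" for a :: 'a and s
    using emeasure_bounded_finite[OF bounded_ball] by (auto simp: fmeasurable_def)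
  then have U: "(\<Union>j\<in>J. ?B j) \<in> fmeasurable lborel"
    using \<open>finite J\<close> by (intro fmeasurable.finite_UN) auto
  have "real (card J) * (?V * (d / 2) ^ ?n) = (\<Sum>j\<in>J. measure lborel (?B j))"
    using \<open>0 < d\<close> by (simp add: content_ball)
  also have "\<dots> = measure lborel (\<Union>j\<in>J. ?B j)"
    using disj \<open>finite J\<close> emeasure_bounded_finite[OF bounded_ball]
    by (intro measure_finite_Union[symmetric]) (auto simp: less_top)
  finally have 1: "real (card J) * (?V * (d / 2) ^ ?n) = measure lborel (\<Union>j\<in>J. ?B j)" .
  have "measure lborel (\<Union>j\<in>J. ?B j) + measure lborel (ball c (R - d / 2))
      = measure lborel ((\<Union>j\<in>J. ?B j) \<union> ball c (R - d / 2))"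
    using U empty ball by (subst measure_Un3) auto
  also have "\<dots> \<le> measure lborel (ball c (R + d / 2))"
    using sub fmeasurable.Un[OF U ball] ball by (intro measure_mono_fmeasurable fmeasurableD)
  finally have "?V * (real (card J) * (d / 2) ^ ?n) \<le> ?V * ((R + d / 2) ^ ?n - (R - d / 2) ^ ?n)"
    using 1 assms by (simp add: content_ball algebra_simps)
  then show ?thesis
    by (simp add: mult_le_cancel_left_pos)
qed

text \<open>Intermediate values between t = r, where the distance to c is at most 2 r, and t = 3 r,
  where it is at least 2 r. The bound t >= r is kept because the separation estimate rests on
  it.\<close>

lemma ray_meets_sphere:
  fixes p u c :: "'a::euclidean_space"
  assumes "norm u = 1" "norm (p - c) \<le> r"
  obtains t where "t \<ge> r" "norm (p + t *\<^sub>R u - c) = 2 * r"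
proof -
  have r0: "r \<ge> 0" using assms(2) norm_ge_zero order_trans by blast
  have "\<exists>t\<ge>r. t \<le> 3 * r \<and> norm (p + t *\<^sub>R u - c) = 2 * r"
  proof (rule IVT')
    have "norm (p + r *\<^sub>R u - c) \<le> norm (p - c) + norm (r *\<^sub>R u)"
      using norm_triangle_ineq[of "p - c" "r *\<^sub>R u"] by (simp add: algebra_simps)
    then show "norm (p + r *\<^sub>R u - c) \<le> 2 * r" using assms r0 by simp
    have "norm ((3 * r) *\<^sub>R u) \<le> norm (p + (3 * r) *\<^sub>R u - c) + norm (p - c)"
      using norm_triangle_ineq4[of "p + (3 * r) *\<^sub>R u - c" "p - c"] by (simp add: algebra_simps)
    then show "2 * r \<le> norm (p + (3 * r) *\<^sub>R u - c)" using assms r0 by simp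
  qed (use r0 in \<open>auto intro!: continuous_intros\<close>)
  then show ?thesis using that by blast
qed

text \<open>Here p' + \<delta> u' is the later vertex, and \<open>cut\<close> says that it satisfies
  the earlier half-space. With D = p - p' and c = u . u', the squared distance is D . D + 2 (t D . u
  - t' D . u') + (t - t')^2 + 2 t t' (1 - c). The second term is at least 2 r m c, the last at least
  2 r m (1 - c).\<close>

lemma tangent_points_separated:
  fixes p p' u u' :: "'a::real_inner"
  assumes u: "norm u = 1" "norm u' = 1"
    and sup: "u \<bullet> (p' - p) \<le> 0" "u' \<bullet> (p - p') \<le> 0"
    and cut: "u \<bullet> (p' + \<delta> *\<^sub>R u' - p) \<le> 0"
    and m: "0 \<le> m" "m \<le> \<delta>" "m \<le> r"
    and t: "r \<le> t" "r \<le> t'"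
  shows "2 * r * m \<le> (dist (p + t *\<^sub>R u) (p' + t' *\<^sub>R u'))\<^sup>2"
proof -
  define c D where "c = u \<bullet> u'" and "D = p - p'"
  have c1: "c \<le> 1"
    using norm_cauchy_schwarz[of u u'] u by (simp add: c_def)
  have D: "0 \<le> D \<bullet> u" "0 \<le> - (D \<bullet> u')" "\<delta> * c \<le> D \<bullet> u"
    using sup cut by (auto simp: D_def c_def algebra_simps inner_commute)
  \<comment> \<open>For negative c the passage from \<delta> to the smaller m goes the wrong way,
    but then \<open>sup\<close> suffices, since m c <= 0 <= D . u.\<close>
  have mc: "m * c \<le> D \<bullet> u"
  proof (cases "c \<ge> 0")
    case True
    then show ?thesis using m D mult_right_mono[of m \<delta> c] by linarith
  next
    case False
    then show ?thesis using m D mult_nonneg_nonpos[of m c] by linarith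
  qed
  have "r * (m * c) \<le> r * (D \<bullet> u)"
    using mc m by (intro mult_left_mono) auto
  also have "\<dots> \<le> t * (D \<bullet> u)"
    using t D by (intro mult_right_mono)
  also have "\<dots> \<le> t * (D \<bullet> u) + t' * - (D \<bullet> u')"
    using t m D mult_nonneg_nonneg[of t' "- (D \<bullet> u')"] by linarith
  finally have 1: "r * (m * c) \<le> t * (D \<bullet> u) - t' * (D \<bullet> u')" by simp
  have "r * m \<le> t * t'"
    using t m by (intro mult_mono) auto
  then have 2: "r * m * (1 - c) \<le> t * t' * (1 - c)"
    using c1 by (intro mult_right_mono) auto
  define a b where "a = t * (D \<bullet> u) - t' * (D \<bullet> u')" and "b = t * t' * (1 - c)"
  have uu: "u \<bullet> u = 1" "u' \<bullet> u' = 1"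
    using u by (auto simp: dot_square_norm)
  have "2 * r * m = 2 * (r * (m * c)) + 2 * (r * m * (1 - c))"
    by (simp add: algebra_simps)
  also have "\<dots> \<le> D \<bullet> D + 2 * a + (t - t')\<^sup>2 + 2 * b"
    using 1 2 inner_ge_zero[of D] zero_le_power2[of "t - t'"] unfolding a_def[symmetric] b_def[symmetric]
    by linarith
  also have "\<dots> = (D + t *\<^sub>R u - t' *\<^sub>R u') \<bullet> (D + t *\<^sub>R u - t' *\<^sub>R u')"
    using uu by (simp add: a_def b_def inner_simps c_def power2_eq_square inner_commute algebra_simps)
  also have "\<dots> = (dist (p + t *\<^sub>R u) (p' + t' *\<^sub>R u'))\<^sup>2"
    by (simp add: dist_norm D_def power2_norm_eq_inner algebra_simps)
  finally show ?thesis .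
qed

text \<open>\<open>sup\<close> makes p j the projection of v j onto A. The k + 1 lifted points of
  the steps 0 to k are packed on the sphere of radius 2 r about c; t is the packing radius d/2 in
  units of 2 r.\<close>

lemma cutting_scheme_count:
  fixes p v :: "nat \<Rightarrow> 'a::euclidean_space"
  assumes ball: "A \<subseteq> cball c r" and r: "r > 0"
    and p: "\<And>j. p j \<in> A" and v: "\<And>j. v j \<noteq> p j"
    and sup: "\<And>j y. y \<in> A \<Longrightarrow> (v j - p j) \<bullet> (y - p j) \<le> 0"
    and cut: "\<And>i j. i < j \<Longrightarrow> (v i - p i) \<bullet> (v j - p i) \<le> 0"
    and mono: "\<And>i j. i \<le> j \<Longrightarrow> norm (v j - p j) \<le> norm (v i - p i)"
    and t: "t = sqrt (2 * r * min (norm (v k - p k)) r) / (4 * r)"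
  shows "real (Suc k) * t ^ (DIM('a) - 1) \<le> 2 * real DIM('a) * (1 + t) ^ (DIM('a) - 1)"
proof -
  let ?n = "DIM('a)"
  define \<delta> where "\<delta> j = norm (v j - p j)" for j
  define u where "u j = (v j - p j) /\<^sub>R \<delta> j" for j
  \<comment> \<open>One separation parameter for all steps up to k: the distances do not increase,
    so the last one is the smallest. The cap at r is what the separation estimate demands.\<close>
  define m where "m = min (\<delta> k) r"
  define d where "d = sqrt (2 * r * m)"
  have \<delta>: "\<delta> j > 0" for j using v by (simp add: \<delta>_def)
  have u: "norm (u j) = 1" for j using \<delta>[of j] by (simp add: u_def \<delta>_def)
  have m: "m > 0" "m \<le> r" "\<And>j. j \<le> k \<Longrightarrow> m \<le> \<delta> j"
    using \<delta>[of k] r mono by (fastforce simp: m_def \<delta>_def)+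
  have u_sup: "u j \<bullet> (y - p j) \<le> 0" if "y \<in> A" for j y
    using sup[OF that, of j] \<delta>[of j] by (simp add: u_def divide_simps)
  have u_cut: "u i \<bullet> (p j + \<delta> j *\<^sub>R u j - p i) \<le> 0" if "i < j" for i j
    using cut[OF that] \<delta>[of i] \<delta>[of j] by (simp add: u_def divide_simps)
  have "\<forall>j. \<exists>s\<ge>r. norm (p j + s *\<^sub>R u j - c) = 2 * r"
    using ray_meets_sphere[OF u] p ball by (metis mem_cball dist_commute dist_norm subsetD)
  then obtain s where s: "\<And>j. s j \<ge> r" "\<And>j. norm (p j + s j *\<^sub>R u j - c) = 2 * r" by metis
  define x where "x j = p j + s j *\<^sub>R u j" for j
  have sep1: "d \<le> dist (x i) (x j)" if "i < j" "j \<le> k" for i j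
  proof -
    have "2 * r * m \<le> (dist (x i) (x j))\<^sup>2"
      unfolding x_def using that m(3)[of j] m u_sup u_cut p
      by (intro tangent_points_separated[where \<delta> = "\<delta> j"] u s) auto
    then show ?thesis unfolding d_def by (intro real_le_lsqrt) auto
  qed
  have sep: "d \<le> dist (x i) (x j)" if "i \<in> {..k}" "j \<in> {..k}" "i \<noteq> j" for i j
    using that sep1[of i j] sep1[of j i] by (cases "i < j") (auto simp: dist_commute)
  have d: "0 < d" "d \<le> 2 * r"
  proof -
    show "0 < d" using m r by (simp add: d_def)
    have "2 * r * m \<le> 2 * r * r" using m r by simp
    also have "\<dots> \<le> (2 * r)\<^sup>2" using r by (simp add: power2_eq_square)
    finally show "d \<le> 2 * r" unfolding d_def using r by (intro real_le_lsqrt) auto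
  qed
  have t_d: "t = d / (4 * r)" using t by (simp add: d_def m_def \<delta>_def)
  have t0: "0 < t" "t \<le> 1" using d r by (auto simp: t_d)
  have "real (card {..k}) * (d / 2) ^ ?n \<le> (2 * r + d / 2) ^ ?n - (2 * r - d / 2) ^ ?n"
    using d s sep by (intro sphere_packing_bound[where c = c and x = x])
      (auto simp: x_def dist_norm norm_minus_commute)
  moreover have "d / 2 = (2 * r) * t" "2 * r + d / 2 = (2 * r) * (1 + t)" "2 * r - d / 2 = (2 * r) * (1 - t)"
    using r by (auto simp: t_d field_simps)
  ultimately have "(2 * r) ^ ?n * (real (Suc k) * t ^ ?n) \<le> (2 * r) ^ ?n * ((1 + t) ^ ?n - (1 - t) ^ ?n)"
    by (simp only: power_mult_distrib card_atMost) (simp add: algebra_simps)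
  then have "real (Suc k) * t ^ ?n \<le> (1 + t) ^ ?n - (1 - t) ^ ?n"
    using r by (simp add: mult_le_cancel_left_pos)
  \<comment> \<open>The shell volume is linear in t to first order; cancelling this t lowers the
    exponent from the dimension to the dimension minus one.\<close>
  also have "\<dots> \<le> real ?n * ((1 + t) - (1 - t)) * (1 + t) ^ (?n - 1)"
    using t0 by (intro power_diff_le_mult) auto
  also have "\<dots> = t * (2 * real ?n * (1 + t) ^ (?n - 1))"
    by simp
  also have "t ^ ?n = t * t ^ (?n - 1)"
    by (simp add: power_eq_if)
  finally have "t * (real (Suc k) * t ^ (?n - 1)) \<le> t * (2 * real ?n * (1 + t) ^ (?n - 1))"
    by (simp add: mult_ac)
  then show ?thesis using t0 by (simp add: mult_le_cancel_left_pos)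
qed

text \<open>The count bounds t/(1+t) by a multiple of k^(-1/m) with m = n - 1. Hence t tends to 0,
  so that eventually the factor 1 + t costs only \<epsilon> and the cap at r is inactive; the
  distance is then exactly 8 r t^2.\<close>

lemma cutting_scheme_rate:
  fixes p v :: "nat \<Rightarrow> 'a::euclidean_space"
  defines "n \<equiv> real DIM('a)"
  defines "Q \<equiv> n * unit_ball_vol n / unit_ball_vol (n - 1)"
  assumes dim: "DIM('a) \<ge> 2"
    and ball: "A \<subseteq> cball c r" and r: "r > 0"
    and p: "\<And>j. p j \<in> A" and v: "\<And>j. v j \<noteq> p j"
    and sup: "\<And>j y. y \<in> A \<Longrightarrow> (v j - p j) \<bullet> (y - p j) \<le> 0"
    and cut: "\<And>i j. i < j \<Longrightarrow> (v i - p i) \<bullet> (v j - p i) \<le> 0"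
    and mono: "\<And>i j. i \<le> j \<Longrightarrow> norm (v j - p j) \<le> norm (v i - p i)"
    and \<epsilon>: "\<epsilon> > 0"
  shows "\<exists>K. \<forall>k\<ge>K. norm (v k - p k)
      \<le> (1 + \<epsilon>) * (16 * r * Q powr (2 / (n - 1))) * real k powr (2 / (1 - n))"
proof -
  define t where "t k = sqrt (2 * r * min (norm (v k - p k)) r) / (4 * r)" for k
  define m where "m = n - 1"
  have m: "m \<ge> 1" "real (DIM('a) - 1) = m" using dim by (auto simp: m_def n_def)
  have n: "n \<ge> 2" using dim by (simp add: n_def)
  have t0: "0 < t k" "t k \<le> 1" for k
  proof -
    have mn: "0 < min (norm (v k - p k)) r" "min (norm (v k - p k)) r \<le> r"
      using v r by (auto simp: min_def)
    show "0 < t k" using mn r by (simp add: t_def)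
    have "2 * r * min (norm (v k - p k)) r \<le> 2 * r * r" using mn r by simp
    also have "\<dots> \<le> (4 * r)\<^sup>2" using r by (simp add: power2_eq_square)
    finally have "sqrt (2 * r * min (norm (v k - p k)) r) \<le> 4 * r"
      using r by (intro real_le_lsqrt) auto
    then show "t k \<le> 1" using r by (simp add: t_def)
  qed
  have tsq: "min (norm (v k - p k)) r = 8 * r * (t k)\<^sup>2" for k
    using r by (simp add: t_def power_divide real_sqrt_pow2 field_simps power2_eq_square)
  have Q: "Q > 0" using n by (simp add: Q_def)
  have bound: "t k / (1 + t k) \<le> sqrt 2 * Q powr (1 / m) * real k powr (- 1 / m)" if "k \<ge> 1" for k
  proof -
    define s where "s = t k / (1 + t k)"
    have s: "0 < s" using t0[of k] by (simp add: s_def)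
    have "real (Suc k) * t k ^ (DIM('a) - 1) \<le> 2 * real DIM('a) * (1 + t k) ^ (DIM('a) - 1)"
      using cutting_scheme_count[OF ball r p v sup cut mono, of "\<lambda>x. x"] t_def by blast
    then have "real (Suc k) * s ^ (DIM('a) - 1) \<le> 2 * n"
      using t0[of k] by (simp add: s_def n_def power_divide divide_le_eq)
    then have "real k * s ^ (DIM('a) - 1) \<le> 2 * n"
      using s by (smt (verit) mult_right_mono of_nat_Suc zero_le_power)
    \<comment> \<open>Trades the packing constant for \<open>Q\<close>; the surplus
      \<open>sqrt 2 powr m\<close> shrinks to \<open>sqrt 2\<close> under the m-th root taken
      below.\<close>
    also have "2 * n \<le> sqrt 2 powr m * Q"
    proof -
      have "4 * (unit_ball_vol m)\<^sup>2 \<le> 2 ^ (DIM('a) - 1) * (unit_ball_vol n)\<^sup>2"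
        using unit_ball_vol_ratio[of "DIM('a) - 1"] dim m by (simp add: m_def)
      also have "(2::real) ^ (DIM('a) - 1) = (sqrt 2 powr m)\<^sup>2"
      proof -
        have "sqrt 2 powr m = sqrt 2 ^ (DIM('a) - 1)"
          using powr_realpow[of "sqrt 2" "DIM('a) - 1"] unfolding m(2) by simp
        then show ?thesis
          by (simp add: power2_eq_square power_mult_distrib[symmetric])
      qed
      finally have "(2 * unit_ball_vol m)\<^sup>2 \<le> (sqrt 2 powr m * unit_ball_vol n)\<^sup>2"
        by (simp add: power_mult_distrib)
      then have "2 * unit_ball_vol m \<le> sqrt 2 powr m * unit_ball_vol n"
        by (rule power2_le_imp_le) (rule mult_nonneg_nonneg, use n in simp_all)
      then have "n * (2 * unit_ball_vol m) \<le> n * (sqrt 2 powr m * unit_ball_vol n)"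
        by (rule mult_left_mono) (use n in simp)
      moreover have "unit_ball_vol m > 0" using m by simp
      ultimately show ?thesis
        by (simp add: Q_def m_def[symmetric] pos_le_divide_eq mult_ac)
    qed
    finally have "s ^ (DIM('a) - 1) \<le> sqrt 2 powr m * Q * real k powr (- 1)"
      using that by (simp add: powr_minus field_simps)
    moreover have "s ^ (DIM('a) - 1) = s powr m"
      using s m by (simp add: powr_realpow[symmetric])
    ultimately have "(s powr m) powr (1 / m) \<le> (sqrt 2 powr m * Q * real k powr (- 1)) powr (1 / m)"
      using m by (intro powr_mono2) auto
    also have "(s powr m) powr (1 / m) = s"
      using m s by (simp add: powr_powr)
    also have "(sqrt 2 powr m * Q * real k powr (- 1)) powr (1 / m)
        = (sqrt 2 powr m) powr (1 / m) * Q powr (1 / m) * (real k powr (- 1)) powr (1 / m)"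
      using Q by (simp only: powr_mult)
    also have "\<dots> = sqrt 2 * Q powr (1 / m) * real k powr (- 1 / m)"
      using m by (simp only: powr_powr) simp
    finally show ?thesis
      by (simp add: s_def)
  qed
  have lim: "(\<lambda>k. t k) \<longlonglongrightarrow> 0"
  proof (rule tendsto_sandwich[where f = "\<lambda>_. 0"
        and h = "\<lambda>k. 2 * (sqrt 2 * Q powr (1 / m)) * real k powr (- 1 / m)"])
    have "((\<lambda>k. real k powr (- 1 / m)) \<longlongrightarrow> 0) sequentially"
      using m by (intro tendsto_neg_powr filterlim_real_sequentially) auto
    from tendsto_mult_right[OF this, of "2 * (sqrt 2 * Q powr (1 / m))"]
    show "(\<lambda>k. 2 * (sqrt 2 * Q powr (1 / m)) * real k powr (- 1 / m)) \<longlonglongrightarrow> 0"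
      by (simp add: mult_ac)
    have "t k \<le> 2 * (sqrt 2 * Q powr (1 / m)) * real k powr (- 1 / m)" if "k \<ge> 1" for k
    proof -
      have "t k \<le> 2 * (t k / (1 + t k))"
        using t0[of k] by (simp add: pos_le_divide_eq)
      also have "\<dots> \<le> 2 * (sqrt 2 * Q powr (1 / m) * real k powr (- 1 / m))"
        using bound[OF that] by (rule mult_left_mono) simp
      finally show ?thesis by (simp only: mult.assoc)
    qed
    then show "\<forall>\<^sub>F k in sequentially. t k \<le> 2 * (sqrt 2 * Q powr (1 / m)) * real k powr (- 1 / m)"
      unfolding eventually_sequentially by blast
    show "\<forall>\<^sub>F k in sequentially. 0 \<le> t k"
      using t0 by (auto intro!: always_eventually less_imp_le)
  qed simp
  \<comment> \<open>The first entry gives (1 + t)^2 <= 1 + \<epsilon>. The second gives 8 r t^2 <= 8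
    r / 9 < r, so the minimum with r is the distance itself.\<close>
  define e where "e = min (sqrt (1 + \<epsilon>) - 1) (1 / 3)"
  have e: "e > 0" using \<epsilon> by (simp add: e_def)
  have "\<forall>\<^sub>F k in sequentially. t k < e"
    using order_tendstoD(2)[OF lim e] .
  then obtain K where K: "\<And>k. k \<ge> K \<Longrightarrow> t k < e" by (auto simp: eventually_sequentially)
  have "norm (v k - p k) \<le> (1 + \<epsilon>) * (16 * r * Q powr (2 / (n - 1))) * real k powr (2 / (1 - n))"
    if k: "k \<ge> max K 1" for k
  proof -
    have tk: "t k < e" using K k by auto
    have t2: "(t k)\<^sup>2 \<le> (1 / 3)\<^sup>2"
      using tk t0[of k] by (intro power_mono) (auto simp: e_def)
    have "8 * r * (t k)\<^sup>2 < r"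
      using mult_left_mono[OF t2, of "8 * r"] r by (simp add: power2_eq_square)
    then have "norm (v k - p k) = 8 * r * (t k)\<^sup>2"
      using tsq[of k] by (auto simp: min_def split: if_splits)
    moreover have "(t k)\<^sup>2 \<le> (1 + \<epsilon>) * (2 * Q powr (2 / m) * real k powr (- 2 / m))"
    proof -
      have "t k \<le> (1 + t k) * (sqrt 2 * Q powr (1 / m) * real k powr (- 1 / m))"
        using bound[of k] k t0[of k] by (simp add: pos_divide_le_eq mult_ac)
      also have "\<dots> \<le> sqrt (1 + \<epsilon>) * (sqrt 2 * Q powr (1 / m) * real k powr (- 1 / m))"
        using tk by (intro mult_right_mono) (auto simp: e_def)
      finally have "(t k)\<^sup>2 \<le> (sqrt (1 + \<epsilon>) * (sqrt 2 * Q powr (1 / m) * real k powr (- 1 / m)))\<^sup>2"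
        using t0[of k] by (intro power_mono) auto
      also have "\<dots> = (1 + \<epsilon>) * (2 * (Q powr (1 / m))\<^sup>2 * (real k powr (- 1 / m))\<^sup>2)"
        using \<epsilon> by (simp add: power_mult_distrib)
      also have "(Q powr (1 / m))\<^sup>2 = Q powr (2 / m)"
        by (simp add: power2_eq_square powr_add[symmetric])
      also have "(real k powr (- 1 / m))\<^sup>2 = real k powr (- 2 / m)"
        by (simp add: power2_eq_square powr_add[symmetric])
      finally show ?thesis .
    qed
    ultimately have "norm (v k - p k) \<le> 8 * r * ((1 + \<epsilon>) * (2 * Q powr (2 / m) * real k powr (- 2 / m)))"
      using r by (simp add: mult_left_mono)
    moreover have "- 2 / m = 2 / (1 - n)"
      using m by (simp add: m_def field_simps)
    ultimately show ?thesis by (simp add: m_def mult_ac)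
  qed
  then show ?thesis by blast
qed

subsection \<open>The principal square root of a matrix\<close>

lemma linear_term_zero:
  fixes b c :: real
  assumes "\<And>s. 0 \<le> 2 * s * b + s\<^sup>2 * c"
  shows "b = 0"
proof (rule ccontr)
  assume b: "b \<noteq> 0"
  define k where "k = \<bar>c\<bar> + 1"
  have k: "k > 0" "c < k" by (auto simp: k_def)
  \<comment> \<open>The step is directed against b and so short, since k > c, that the linear term
    outweighs the quadratic one.\<close>
  have "0 \<le> 2 * (- b / k) * b + (- b / k)\<^sup>2 * c" by (rule assms)
  also have "\<dots> = (b\<^sup>2 / k\<^sup>2) * (c - 2 * k)"
    using k by (simp add: field_simps power2_eq_square)
  also have "\<dots> < 0"
    using b k by (intro mult_pos_neg) auto
  finally show False by simp
qed

text \<open>Maximise the Rayleigh quotient on the unit sphere of S. The first-order condition makes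
  the residual \<mu> x - f x orthogonal to S; by invariance it lies in S as well, so it vanishes.
  Maximality of \<mu> is part of the conclusion because the uniqueness of the square root uses
  it.\<close>

lemma selfadjoint_max_eigenvector:
  fixes f :: "'a::euclidean_space \<Rightarrow> 'a"
  assumes f: "linear f" and sa: "\<And>x y. x \<bullet> f y = f x \<bullet> y"
    and S: "subspace S" "S \<noteq> {0}" "f ` S \<subseteq> S"
  obtains x \<mu> where "x \<in> S" "norm x = 1" "f x = \<mu> *\<^sub>R x" "\<And>y. y \<in> S \<Longrightarrow> y \<bullet> f y \<le> \<mu> * (y \<bullet> y)"
proof -
  have "0 \<in> S" using S(1) by (rule subspace_0)
  then obtain z where z: "z \<in> S" "z \<noteq> 0" using S(2) by blast
  then have "z /\<^sub>R norm z \<in> S \<inter> sphere 0 1"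
    using S(1) by (auto simp: subspace_scale)
  then have ne: "S \<inter> sphere 0 1 \<noteq> {}"
    by blast
  have "compact (S \<inter> sphere 0 1)"
    using S(1) by (simp add: closed_Int_compact closed_subspace)
  moreover have "continuous_on (S \<inter> sphere 0 1) (\<lambda>x. x \<bullet> f x)"
    using linear_continuous_on[of f] f by (intro continuous_intros) (simp add: linear_conv_bounded_linear)
  ultimately obtain x where "x \<in> S \<inter> sphere 0 1" and "\<forall>y\<in>S \<inter> sphere 0 1. y \<bullet> f y \<le> x \<bullet> f x"
    using continuous_attains_sup[OF _ ne] by blast
  then have x: "x \<in> S" "norm x = 1" and mx: "\<And>y. y \<in> S \<Longrightarrow> norm y = 1 \<Longrightarrow> y \<bullet> f y \<le> x \<bullet> f x"
    by auto
  define \<mu> where "\<mu> = x \<bullet> f x"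
  have le: "y \<bullet> f y \<le> \<mu> * (y \<bullet> y)" if "y \<in> S" for y
  proof (cases "y = 0")
    case False
    have "(y /\<^sub>R norm y) \<bullet> f (y /\<^sub>R norm y) \<le> \<mu>"
      unfolding \<mu>_def using False that S(1) by (intro mx) (auto simp: subspace_scale)
    then have "(y \<bullet> f y) / (norm y)\<^sup>2 \<le> \<mu>"
      using f by (simp add: linear_scale power2_eq_square divide_inverse mult_ac)
    then show ?thesis
      using False by (simp add: divide_le_eq power2_norm_eq_inner)
  qed simp
  have xx: "x \<bullet> x = 1" using x by (simp add: dot_square_norm)
  have orth: "(\<mu> *\<^sub>R x - f x) \<bullet> y = 0" if "y \<in> S" for y
  proof (rule linear_term_zero[where c = "\<mu> * (y \<bullet> y) - y \<bullet> f y"])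
    fix s :: real
    have "(x + s *\<^sub>R y) \<bullet> f (x + s *\<^sub>R y) \<le> \<mu> * ((x + s *\<^sub>R y) \<bullet> (x + s *\<^sub>R y))"
      using x that S(1) by (intro le) (auto intro: subspace_add subspace_scale)
    moreover have "x \<bullet> f y = y \<bullet> f x" by (metis sa inner_commute)
    ultimately show "0 \<le> 2 * s * ((\<mu> *\<^sub>R x - f x) \<bullet> y) + s\<^sup>2 * (\<mu> * (y \<bullet> y) - y \<bullet> f y)"
      using f xx \<mu>_def
      by (simp add: linear_add linear_scale inner_simps inner_commute algebra_simps power2_eq_square)
  qed
  have "\<mu> *\<^sub>R x - f x \<in> S"
    using x S by (auto intro!: subspace_diff subspace_scale)
  from orth[OF this] have "f x = \<mu> *\<^sub>R x" by simp
  then show ?thesis using that x le by blast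
qed

text \<open>Induction on the dimension: split off one eigenvector. Self-adjointness keeps its
  orthogonal complement in S invariant. Working with subspaces lets the induction stay in one
  type.\<close>

lemma selfadjoint_orthonormal_eigenbasis:
  fixes f :: "'a::euclidean_space \<Rightarrow> 'a"
  assumes f: "linear f" and sa: "\<And>x y. x \<bullet> f y = f x \<bullet> y"
    and S: "subspace S" "f ` S \<subseteq> S"
  shows "\<exists>B. finite B \<and> B \<subseteq> S \<and> (\<forall>b\<in>B. \<forall>b'\<in>B. b \<bullet> b' = (if b = b' then 1 else 0))
    \<and> (\<forall>b\<in>B. \<exists>\<mu>. f b = \<mu> *\<^sub>R b) \<and> (\<forall>y\<in>S. y = (\<Sum>b\<in>B. (b \<bullet> y) *\<^sub>R b))"
  using S
proof (induction "dim S" arbitrary: S rule: less_induct)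
  case less
  show ?case
  proof (cases "S = {0}")
    case True
    then show ?thesis by (intro exI[of _ "{}"]) auto
  next
    case False
    obtain x \<mu> where x: "x \<in> S" "norm x = 1" "f x = \<mu> *\<^sub>R x"
      using selfadjoint_max_eigenvector[OF f sa less.prems(1) False less.prems(2)] by metis
    have xx: "x \<bullet> x = 1" using x by (simp add: dot_square_norm)
    define S' where "S' = {y \<in> S. x \<bullet> y = 0}"
    have sub: "subspace S'"
      using less.prems(1) by (auto simp: S'_def subspace_def inner_simps)
    have inv: "f ` S' \<subseteq> S'"
      using less.prems(2) sa[of x] x(3) by (auto simp: S'_def)
    have "x \<notin> S'" using xx by (simp add: S'_def)
    then have "S' \<subset> S" using x(1) unfolding S'_def by blast
    then have "dim S' < dim S"
      using sub less.prems(1) by (intro dim_psubset) (simp add: span_eq_iff[THEN iffD2])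
    from less.hyps[OF this sub inv] obtain B where B: "finite B" "B \<subseteq> S'"
      "\<forall>b\<in>B. \<forall>b'\<in>B. b \<bullet> b' = (if b = b' then 1 else 0)" "\<forall>b\<in>B. \<exists>\<mu>. f b = \<mu> *\<^sub>R b"
      and expand: "\<forall>y\<in>S'. y = (\<Sum>b\<in>B. (b \<bullet> y) *\<^sub>R b)" by (elim exE conjE) (rule that)
    have xB: "x \<notin> B" "\<forall>b\<in>B. x \<bullet> b = 0" "\<forall>b\<in>B. b \<bullet> x = 0"
      using B(2) \<open>x \<notin> S'\<close> by (auto simp: S'_def inner_commute)
    show ?thesis
    proof (intro exI[of _ "insert x B"] conjI ballI)
      fix y assume y: "y \<in> S"
      define z where "z = y - (x \<bullet> y) *\<^sub>R x"
      have "z \<in> S'"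
        using y x less.prems(1) xx by (auto simp: S'_def z_def inner_simps subspace_diff subspace_scale)
      then have "z = (\<Sum>b\<in>B. (b \<bullet> z) *\<^sub>R b)" using expand by blast
      also have "\<dots> = (\<Sum>b\<in>B. (b \<bullet> y) *\<^sub>R b)"
        using xB by (intro sum.cong) (auto simp: z_def inner_simps)
      finally show "y = (\<Sum>b\<in>insert x B. (b \<bullet> y) *\<^sub>R b)"
        using xB B(1) by (simp add: z_def algebra_simps)
    qed (use B xB x xx in \<open>auto simp: S'_def\<close>)
  qed
qed

lemma sym_pos_def_alt:
  "sym_pos_def M \<longleftrightarrow> (\<forall>x y. x \<bullet> (M *v y) = (M *v x) \<bullet> y) \<and> (\<forall>y. y \<noteq> 0 \<longrightarrow> 0 < y \<bullet> (M *v y))"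
proof -
  have "transpose M = M \<longleftrightarrow> (\<forall>x y. x \<bullet> (M *v y) = (M *v x) \<bullet> y)"
  proof
    assume "transpose M = M"
    then show "\<forall>x y. x \<bullet> (M *v y) = (M *v x) \<bullet> y"
      by (metis dot_lmul_matrix vector_transpose_matrix)
  next
    assume sa: "\<forall>x y. x \<bullet> (M *v y) = (M *v x) \<bullet> y"
    have "(transpose M *v x) \<bullet> y = (M *v x) \<bullet> y" for x y
      using sa by (metis dot_lmul_matrix transpose_matrix_vector)
    then have "transpose M *v x = M *v x" for x
      by (metis vector_eq_rdot)
    then show "transpose M = M" by (simp add: matrix_eq)
  qed
  then show ?thesis by (simp add: sym_pos_def_def)
qed

text \<open>Spectral construction: \<open>g\<close> has the eigenbasis of M and the square roots of
  its eigenvalues.\<close>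

lemma matrix_sqrt_exists:
  fixes M :: "real^'q^'q"
  assumes "sym_pos_def M"
  shows "\<exists>T. sym_pos_def T \<and> T ** T = M"
proof -
  have sa: "x \<bullet> (M *v y) = (M *v x) \<bullet> y" and pos: "y \<noteq> 0 \<Longrightarrow> 0 < y \<bullet> (M *v y)" for x y
    using assms by (auto simp: sym_pos_def_alt)
  obtain B where B: "finite B" and on: "\<forall>b\<in>B. \<forall>b'\<in>B. b \<bullet> b' = (if b = b' then 1 else 0)"
    and ev: "\<forall>b\<in>B. \<exists>\<mu>. M *v b = \<mu> *\<^sub>R b" and expand: "\<And>y. y = (\<Sum>b\<in>B. (b \<bullet> y) *\<^sub>R b)"
    using selfadjoint_orthonormal_eigenbasis[of "(*v) M" UNIV] sa by auto
  obtain \<mu> where \<mu>: "\<And>b. b \<in> B \<Longrightarrow> M *v b = \<mu> b *\<^sub>R b" using ev by metis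
  have bb: "b \<bullet> b = 1" if "b \<in> B" for b using on that by simp
  have \<mu>_pos: "\<mu> b > 0" if "b \<in> B" for b
  proof -
    have "b \<noteq> 0" using bb[OF that] by auto
    from pos[OF this] show ?thesis using \<mu>[OF that] bb[OF that] by simp
  qed
  define g where "g y = (\<Sum>b\<in>B. (sqrt (\<mu> b) * (b \<bullet> y)) *\<^sub>R b)" for y
  have lin: "linear g"
    by (rule linearI) (simp_all add: g_def inner_simps algebra_simps sum.distrib scaleR_sum_right)
  have bg: "b \<bullet> g y = sqrt (\<mu> b) * (b \<bullet> y)" if "b \<in> B" for b y
  proof -
    have "b \<bullet> g y = (\<Sum>b'\<in>B. if b = b' then sqrt (\<mu> b') * (b' \<bullet> y) else 0)"
      using on that by (auto simp: g_def inner_sum_right intro!: sum.cong)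
    then show ?thesis using B that by simp
  qed
  have xg: "x \<bullet> g y = (\<Sum>b\<in>B. sqrt (\<mu> b) * (b \<bullet> x) * (b \<bullet> y))" for x y
    by (simp add: g_def inner_sum_right inner_commute mult_ac)
  have gg: "g (g y) = M *v y" for y
  proof -
    have "g (g y) = (\<Sum>b\<in>B. (sqrt (\<mu> b) * (sqrt (\<mu> b) * (b \<bullet> y))) *\<^sub>R b)"
      unfolding g_def[of "g y"] by (intro sum.cong) (auto simp: bg)
    also have "\<dots> = (\<Sum>b\<in>B. (b \<bullet> y) *\<^sub>R (M *v b))"
      using \<mu> \<mu>_pos by (intro sum.cong) (auto simp: mult.assoc[symmetric] less_imp_le)
    also have "\<dots> = M *v (\<Sum>b\<in>B. (b \<bullet> y) *\<^sub>R b)"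
      by (simp add: linear_sum[OF matrix_vector_mul_linear] matrix_vector_mult_scaleR)
    also have "\<dots> = M *v y"
      by (rule arg_cong[OF expand[symmetric]])
    finally show ?thesis .
  qed
  have "0 < y \<bullet> g y" if "y \<noteq> 0" for y
  proof -
    have "\<exists>b\<in>B. b \<bullet> y \<noteq> 0"
    proof (rule ccontr)
      assume "\<not> (\<exists>b\<in>B. b \<bullet> y \<noteq> 0)"
      then have "(\<Sum>b\<in>B. (b \<bullet> y) *\<^sub>R b) = 0"
        by (intro sum.neutral) auto
      then have "y = 0"
        by (rule trans[OF expand])
      then show False using that by contradiction
    qed
    then obtain b where b: "b \<in> B" "b \<bullet> y \<noteq> 0" by blast
    have "0 < sqrt (\<mu> b) * ((b \<bullet> y) * (b \<bullet> y))"
      using \<mu>_pos[OF b(1)] b(2) by (simp add: zero_less_mult_iff) linarith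
    moreover have "0 \<le> sqrt (\<mu> b) * ((b \<bullet> y) * (b \<bullet> y))" if "b \<in> B" for b
      using \<mu>_pos[OF that] by simp
    ultimately have "0 < (\<Sum>b\<in>B. sqrt (\<mu> b) * ((b \<bullet> y) * (b \<bullet> y)))"
      using B b(1) by (intro sum_pos2)
    then show ?thesis by (simp add: xg mult.assoc)
  qed
  moreover have "x \<bullet> g y = g x \<bullet> y" for x y
    using xg[of x y] xg[of y x] by (simp add: inner_commute mult_ac)
  moreover have "matrix g *v y = g y" for y
    using lin by (simp add: matrix_works)
  ultimately have "sym_pos_def (matrix g)" "matrix g ** matrix g = M"
    by (simp_all add: sym_pos_def_alt matrix_eq matrix_vector_mul_assoc[symmetric] gg)
  then show ?thesis by blast
qed

text \<open>Test 0 = T^2 - S^2 = T (T - S) + (T - S) S at a unit eigenvector x for the largest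
  eigenvalue \<mu> of T - S. This gives \<mu> (x . Tx + x . Sx) = 0 with a positive bracket, so
  \<mu> = 0.\<close>

lemma sym_pos_def_sqrt_le:
  fixes S T :: "real^'q^'q"
  assumes S: "sym_pos_def S" and T: "sym_pos_def T" and eq: "S ** S = T ** T"
  shows "y \<bullet> (T *v y) \<le> y \<bullet> (S *v y)"
proof -
  have saS: "x \<bullet> (S *v y) = (S *v x) \<bullet> y" and saT: "x \<bullet> (T *v y) = (T *v x) \<bullet> y" for x y
    using S T by (auto simp: sym_pos_def_alt)
  obtain x \<mu> where x: "norm x = 1" "(T - S) *v x = \<mu> *\<^sub>R x"
    and mx: "\<And>y. y \<bullet> ((T - S) *v y) \<le> \<mu> * (y \<bullet> y)"
    using selfadjoint_max_eigenvector[of "(*v) (T - S)" UNIV] UNIV_not_singleton[of "0 :: real^'q"]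
    by (auto simp: matrix_vector_mult_diff_rdistrib inner_diff saS saT)
  have "x \<bullet> (T *v ((T - S) *v x)) + (x \<bullet> ((T - S) *v (S *v x))) = 0"
    using arg_cong[OF eq, of "\<lambda>A. A *v x"]
    by (simp add: matrix_vector_mult_diff_rdistrib matrix_vector_mult_diff_distrib inner_diff
        matrix_vector_mul_assoc[symmetric])
  moreover have "x \<bullet> ((T - S) *v (S *v x)) = ((T - S) *v x) \<bullet> (S *v x)"
    by (simp add: matrix_vector_mult_diff_rdistrib matrix_vector_mult_diff_distrib inner_diff saS saT)
  ultimately have "x \<bullet> (T *v (\<mu> *\<^sub>R x)) + (\<mu> *\<^sub>R x) \<bullet> (S *v x) = 0"
    by (simp only: x(2))
  then have "\<mu> * (x \<bullet> (T *v x) + x \<bullet> (S *v x)) = 0"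
    by (simp add: matrix_vector_mult_scaleR distrib_left)
  moreover have "x \<noteq> 0" using x(1) by auto
  then have "x \<bullet> (T *v x) + x \<bullet> (S *v x) > 0"
    using S T by (simp add: sym_pos_def_def add_pos_pos)
  ultimately have "\<mu> = 0" by simp
  then show ?thesis
    using mx[of y] by (simp add: matrix_vector_mult_diff_rdistrib inner_diff)
qed

text \<open>The comparison above, used in both directions, equates the quadratic forms; polarization
  then equates the matrices.\<close>

lemma matrix_sqrt_unique:
  fixes S T :: "real^'q^'q"
  assumes "sym_pos_def S" "sym_pos_def T" "S ** S = T ** T"
  shows "S = T"
proof -
  have eq: "y \<bullet> (T *v y) = y \<bullet> (S *v y)" for y
    using assms sym_pos_def_sqrt_le by (metis antisym)
  have "x \<bullet> (T *v y) = x \<bullet> (S *v y)" for x y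
  proof -
    have "y \<bullet> (T *v x) = x \<bullet> (T *v y)" "y \<bullet> (S *v x) = x \<bullet> (S *v y)"
      using assms by (auto simp: sym_pos_def_alt) (metis inner_commute)+
    then show ?thesis
      using eq[of "x + y"] eq[of x] eq[of y]
      by (simp add: matrix_vector_right_distrib inner_simps)
  qed
  then show ?thesis by (metis matrix_eq vector_eq_ldot)
qed

lemma matrix_sqrt:
  assumes "sym_pos_def M"
  shows "sym_pos_def (matrix_sqrt M)" "matrix_sqrt M ** matrix_sqrt M = M"
proof -
  have "\<exists>!T. sym_pos_def T \<and> T ** T = M"
    using matrix_sqrt_exists[OF assms] matrix_sqrt_unique by metis
  from theI'[OF this] show "sym_pos_def (matrix_sqrt M)" "matrix_sqrt M ** matrix_sqrt M = M"
    by (simp_all add: matrix_sqrt_def)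
qed

subsection \<open>Norms, multipliers and the Hausdorff distance\<close>

lemma sym_pos_def_inj:
  assumes "sym_pos_def T"
  shows "inj ((*v) T)"
proof -
  have "y = 0" if "T *v y = 0" for y
    using assms that by (force simp: sym_pos_def_def)
  then show ?thesis
    by (simp add: linear_injective_0)
qed

lemma sym_pos_def_surj:
  assumes "sym_pos_def T"
  shows "surj ((*v) T)"
  using sym_pos_def_inj[OF assms] by (intro linear_injective_imp_surjective) auto

lemma mnorm_eq_norm_sqrt:
  assumes "sym_pos_def M"
  shows "mnorm M y = norm (matrix_sqrt M *v y)"
proof -
  let ?T = "matrix_sqrt M"
  have "y \<bullet> (M *v y) = y \<bullet> (?T *v (?T *v y))"
    using matrix_sqrt(2)[OF assms] by (simp add: matrix_vector_mul_assoc)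
  also have "\<dots> = (?T *v y) \<bullet> (?T *v y)"
    using matrix_sqrt(1)[OF assms] by (simp add: sym_pos_def_alt)
  finally show ?thesis by (simp add: mnorm_def norm_eq_sqrt_inner)
qed

text \<open>The norm is differentiable away from 0. With a = T b the hypotheses become norm b <= 1
  and b . Tz >= norm (Tz), the equality case of Cauchy-Schwarz, which forces b = Tz / norm
  (Tz).\<close>

lemma mnorm_subgradient_unique:
  assumes M: "sym_pos_def M" and le: "\<And>z. a \<bullet> z \<le> mnorm M z"
    and z: "z \<noteq> 0" "mnorm M z \<le> a \<bullet> z"
  shows "a = (1 / mnorm M z) *\<^sub>R (M *v z)"
proof -
  let ?T = "matrix_sqrt M"
  note T = matrix_sqrt(1)[OF M]
  obtain b where b: "a = ?T *v b"
    using sym_pos_def_surj[OF T] by (metis surj_def)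
  have ab: "a \<bullet> y = b \<bullet> (?T *v y)" for y
    using T by (simp add: b sym_pos_def_alt)
  obtain y where y: "b = ?T *v y"
    using sym_pos_def_surj[OF T] by (metis surj_def)
  \<comment> \<open>The subgradient inequality tested at the preimage y of b under T.\<close>
  have "norm b * norm b \<le> 1 * norm b"
    using le[of y] by (simp add: ab mnorm_eq_norm_sqrt[OF M] y[symmetric] dot_square_norm power2_eq_square)
  then have nb: "norm b \<le> 1"
    by (cases "norm b = 0") (auto simp: mult_le_cancel_right)
  define n where "n = norm (?T *v z)"
  have "?T *v z \<noteq> 0"
    using T z(1) by (force simp: sym_pos_def_def)
  then have n: "n > 0" by (simp add: n_def)
  have "(norm (b - (1 / n) *\<^sub>R (?T *v z)))\<^sup>2 = (norm b)\<^sup>2 - 2 * (b \<bullet> (?T *v z)) / n + 1"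
    using n by (simp add: power2_norm_eq_inner inner_simps inner_commute n_def dot_square_norm[symmetric] power2_eq_square[symmetric])
  also have "\<dots> \<le> 1 - 2 + 1"
  proof -
    have "(norm b)\<^sup>2 \<le> 1" using nb by (simp add: power_le_one)
    moreover have "n \<le> b \<bullet> (?T *v z)"
      using z(2) by (simp add: ab mnorm_eq_norm_sqrt[OF M] n_def)
    then have "1 \<le> (b \<bullet> (?T *v z)) / n"
      using n by (simp add: pos_le_divide_eq)
    moreover have "2 * (b \<bullet> (?T *v z)) / n = 2 * ((b \<bullet> (?T *v z)) / n)"
      by simp
    ultimately show ?thesis by linarith
  qed
  finally have "b = (1 / n) *\<^sub>R (?T *v z)" by simp
  then have "a = (1 / n) *\<^sub>R (?T *v (?T *v z))"
    by (simp add: b matrix_vector_mult_scaleR)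
  then show ?thesis
    using matrix_sqrt(2)[OF M] by (simp add: n_def mnorm_eq_norm_sqrt[OF M] matrix_vector_mul_assoc)
qed

text \<open>A Lagrange multiplier for one linear constraint, found by hand. Points beyond the
  hyperplane bound l from below, points strictly inside bound it from above. The bounds are
  compatible because a segment joining two such points crosses the hyperplane inside P, where
  \<open>le\<close> applies.\<close>

lemma halfspace_multiplier:
  fixes a b :: "'a::real_inner"
  assumes P: "convex P" and le: "\<And>y. y \<in> P \<Longrightarrow> b \<bullet> y \<le> \<gamma> \<Longrightarrow> \<beta> \<le> a \<bullet> y"
    and y0: "y0 \<in> P" "b \<bullet> y0 < \<gamma>"
  obtains l where "l \<ge> 0" "\<And>y. y \<in> P \<Longrightarrow> \<beta> \<le> a \<bullet> y + l * (b \<bullet> y - \<gamma>)"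
proof -
  \<comment> \<open>The lower bounds on l. Inserting 0 yields l >= 0 and keeps the supremum
    meaningful when no point violates the constraint.\<close>
  define U where "U = insert 0 {(\<beta> - a \<bullet> y) / (b \<bullet> y - \<gamma>) | y. y \<in> P \<and> b \<bullet> y > \<gamma>}"
  have upper: "x \<le> (a \<bullet> y' - \<beta>) / (\<gamma> - b \<bullet> y')" if x: "x \<in> U" and y': "y' \<in> P" "b \<bullet> y' < \<gamma>" for x y'
  proof (cases "x = 0")
    case True
    then show ?thesis using le[of y'] y' by simp
  next
    case False
    then obtain y where y: "y \<in> P" "b \<bullet> y > \<gamma>" "x = (\<beta> - a \<bullet> y) / (b \<bullet> y - \<gamma>)"
      using x by (auto simp: U_def)
    define s s' where "s = b \<bullet> y - \<gamma>" and "s' = \<gamma> - b \<bullet> y'"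
    have s: "s > 0" "s' > 0" using y y' by (auto simp: s_def s'_def)
    \<comment> \<open>The weights are chosen so that z lies on the hyperplane b . z =
      \<gamma>.\<close>
    define z where "z = (s' / (s + s')) *\<^sub>R y + (s / (s + s')) *\<^sub>R y'"
    have "z \<in> P"
      unfolding z_def using s y y' by (intro convexD[OF P]) (auto simp: add_divide_distrib[symmetric])
    have "b \<bullet> z = (s' * (\<gamma> + s) + s * (\<gamma> - s')) / (s + s')"
      by (simp add: z_def inner_simps s_def s'_def add_divide_distrib)
    also have "\<dots> = \<gamma>" using s by (simp add: divide_eq_eq algebra_simps)
    finally have "\<beta> \<le> a \<bullet> z" using le[OF \<open>z \<in> P\<close>] by simp
    also have "a \<bullet> z = (s' * (a \<bullet> y) + s * (a \<bullet> y')) / (s + s')"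
      by (simp add: z_def inner_simps add_divide_distrib)
    finally have "\<beta> * (s + s') \<le> s' * (a \<bullet> y) + s * (a \<bullet> y')"
      using s by (simp add: pos_le_divide_eq)
    then have "(\<beta> - a \<bullet> y) * s' \<le> (a \<bullet> y' - \<beta>) * s"
      by (simp add: algebra_simps)
    then show ?thesis
      using s unfolding y(3) s_def[symmetric] s'_def[symmetric] by (simp add: frac_le_eq divide_simps mult.commute)
  qed
  have bdd: "bdd_above U"
    using upper[OF _ y0] by (rule bdd_aboveI)
  define l where "l = Sup U"
  have "l \<ge> 0" unfolding l_def using bdd by (intro cSup_upper) (auto simp: U_def)
  moreover have "\<beta> \<le> a \<bullet> y + l * (b \<bullet> y - \<gamma>)" if y: "y \<in> P" for y
  proof -
    consider "b \<bullet> y = \<gamma>" | "b \<bullet> y > \<gamma>" | "b \<bullet> y < \<gamma>" by linarith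
    then show ?thesis
    proof cases
      case 1
      then show ?thesis using le[OF y] by simp
    next
      case 2
      then have "(\<beta> - a \<bullet> y) / (b \<bullet> y - \<gamma>) \<le> l"
        unfolding l_def using bdd y by (intro cSup_upper) (auto simp: U_def)
      then show ?thesis using 2 by (simp add: pos_divide_le_eq)
    next
      case 3
      then have "l \<le> (a \<bullet> y - \<beta>) / (\<gamma> - b \<bullet> y)"
        unfolding l_def using upper[OF _ y] by (intro cSup_least) (auto simp: U_def)
      then show ?thesis using 3 by (simp add: pos_le_divide_eq algebra_simps)
    qed
  qed
  ultimately show ?thesis using that by blast
qed

lemma hausdorff_bounds:
  fixes N :: "'a::real_vector \<Rightarrow> real"
  assumes N: "\<And>y. N y \<ge> 0" "N 0 = 0" and sub: "D \<subseteq> B" and ne: "D \<noteq> {}"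
    and le: "\<And>y. y \<in> B \<Longrightarrow> \<exists>z\<in>D. N (y - z) \<le> \<delta>"
  shows "0 \<le> hausdorff N B D" "hausdorff N B D \<le> \<delta>"
proof -
  have bdd: "bdd_below ((\<lambda>x. N (f x)) ` S)" for f :: "'b \<Rightarrow> 'a" and S
    using N by (auto intro: bdd_belowI[of _ 0])
  have "(INF y\<in>B. N (y - z)) = 0" if "z \<in> D" for z
  proof (rule antisym)
    show "(INF y\<in>B. N (y - z)) \<le> 0"
      using that sub N by (intro cINF_lower2[OF bdd, of z]) auto
    show "0 \<le> (INF y\<in>B. N (y - z))"
      using that sub N by (intro cINF_greatest) auto
  qed
  then have 2: "(SUP z\<in>D. INF y\<in>B. N (y - z)) = 0"
    using ne by simp
  have 1: "(SUP y\<in>B. INF z\<in>D. N (y - z)) \<le> \<delta>"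
  proof (rule cSUP_least)
    fix y assume "y \<in> B"
    then show "(INF z\<in>D. N (y - z)) \<le> \<delta>"
      using le cINF_lower2[OF bdd] by metis
  qed (use ne sub in auto)
  have "\<delta> \<ge> 0"
    using le N(1) ne sub by (meson dual_order.trans ex_in_conv subsetD)
  then show "0 \<le> hausdorff N B D" "hausdorff N B D \<le> \<delta>"
    using 1 2 by (auto simp: hausdorff_def)
qed

subsection \<open>Duality for the scalarization\<close>

text \<open>\<open>slater\<close> is what the choice of \<gamma> provides: every \<Gamma> x is a
  Slater point for the constraint on \<open>wbar\<close>, as the construction of the multiplier
  requires.\<close>

locale slice_problem =
  fixes C :: "(real^'q) set" and X :: "(real^'n) set" and \<Gamma> :: "real^'n \<Rightarrow> real^'q"
    and wbar :: "real^'q" and \<gamma> :: real and M :: "real^'q^'q"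
  assumes C: "ordering_cone C"
    and X: "X \<noteq> {}" "compact X" "convex X"
    and \<Gamma>: "continuous_on X \<Gamma>" "cone_convex_on C X \<Gamma>"
    and wbar: "wbar \<in> interior (dual_cone C)"
    and slater: "\<And>x. x \<in> X \<Longrightarrow> wbar \<bullet> \<Gamma> x < \<gamma>"
    and M: "sym_pos_def M"
begin

abbreviation "P \<equiv> upper_image C X \<Gamma>"
abbreviation "A \<equiv> P \<inter> lower_halfspace wbar \<gamma>"
abbreviation T where "T y \<equiv> matrix_sqrt M *v y"

lemma cone_C: "convex C" "0 \<in> C" "y \<in> C \<Longrightarrow> 0 \<le> s \<Longrightarrow> s *\<^sub>R y \<in> C" "y \<in> C \<Longrightarrow> z \<in> C \<Longrightarrow> y + z \<in> C"
proof -
  have *: "convex C" "cone C" "C \<inter> uminus ` C = {0}"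
    using C by (auto simp: ordering_cone_def)
  show "convex C" "0 \<in> C" using * by auto
  show "y \<in> C \<Longrightarrow> 0 \<le> s \<Longrightarrow> s *\<^sub>R y \<in> C" using * by (auto simp: cone_def)
  show "y \<in> C \<Longrightarrow> z \<in> C \<Longrightarrow> y + z \<in> C" using * by (metis convex_cone)
qed

lemma \<Gamma>_in_A: "x \<in> X \<Longrightarrow> \<Gamma> x \<in> A"
  using cone_C(2) slater by (force simp: upper_image_def lower_halfspace_def)

lemma A_nonempty: "A \<noteq> {}"
  using \<Gamma>_in_A X(1) by blast

lemma convex_P: "convex P"
proof (rule convexI)
  fix y1 y2 and u v :: real
  assume "y1 \<in> P" "y2 \<in> P" and uv: "0 \<le> u" "0 \<le> v" "u + v = 1"
  then obtain x1 c1 x2 c2 where x: "x1 \<in> X" "x2 \<in> X" and c: "c1 \<in> C" "c2 \<in> C"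
    and y: "y1 = \<Gamma> x1 + c1" "y2 = \<Gamma> x2 + c2"
    by (auto simp: upper_image_def)
  have v: "v = 1 - u" "u \<in> {0..1}" using uv by auto
  define x where "x = u *\<^sub>R x1 + v *\<^sub>R x2"
  have "x \<in> X" unfolding x_def using x uv X(3) by (auto simp: convex_def)
  have "u *\<^sub>R \<Gamma> x1 + v *\<^sub>R \<Gamma> x2 - \<Gamma> x \<in> C"
    using \<Gamma>(2) x v unfolding cone_convex_on_def cone_le_def x_def by blast
  then have "(u *\<^sub>R \<Gamma> x1 + v *\<^sub>R \<Gamma> x2 - \<Gamma> x) + (u *\<^sub>R c1 + v *\<^sub>R c2) \<in> C"
    using c uv by (intro cone_C(4) cone_C(3))
  moreover have "u *\<^sub>R y1 + v *\<^sub>R y2 = \<Gamma> x + ((u *\<^sub>R \<Gamma> x1 + v *\<^sub>R \<Gamma> x2 - \<Gamma> x) + (u *\<^sub>R c1 + v *\<^sub>R c2))"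
    by (simp add: y algebra_simps)
  ultimately show "u *\<^sub>R y1 + v *\<^sub>R y2 \<in> P"
    unfolding upper_image_def using \<open>x \<in> X\<close> by blast
qed

lemma convex_A: "convex A"
  unfolding lower_halfspace_def by (intro convex_Int convex_P convex_halfspace_le)

lemma primal_feasible_iff:
  "primal_feasible C X \<Gamma> wbar \<gamma> v (x, z) \<longleftrightarrow> x \<in> X \<and> v + z - \<Gamma> x \<in> C \<and> wbar \<bullet> (v + z) \<le> \<gamma>"
  by (simp add: primal_feasible_def cone_le_def algebra_simps)

text \<open>Eliminating x identifies the scalarization with the projection of v onto A in the
  M-norm, since v + z ranges over exactly the points of A.\<close>

lemma primal_optimalD:
  assumes "primal_optimal M C X \<Gamma> wbar \<gamma> v xz"
  shows "v + snd xz \<in> A" "\<And>y. y \<in> A \<Longrightarrow> mnorm M (snd xz) \<le> mnorm M (y - v)"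
proof -
  obtain x z where xz: "xz = (x, z)" by (cases xz)
  have feas: "primal_feasible C X \<Gamma> wbar \<gamma> v (x, z)"
    and opt: "\<And>x' z'. primal_feasible C X \<Gamma> wbar \<gamma> v (x', z') \<Longrightarrow> mnorm M z \<le> mnorm M z'"
    using assms by (auto simp: xz primal_optimal_def is_arg_min_def not_less)
  have f: "x \<in> X" "v + z - \<Gamma> x \<in> C" "wbar \<bullet> (v + z) \<le> \<gamma>"
    using feas by (simp_all add: primal_feasible_iff)
  have "v + z = \<Gamma> x + (v + z - \<Gamma> x)" by simp
  with f have "v + z \<in> P"
    unfolding upper_image_def mem_Collect_eq by blast
  then show "v + snd xz \<in> A"
    using f by (simp add: lower_halfspace_def xz)
  fix y assume "y \<in> A"
  then obtain x' c where "x' \<in> X" "c \<in> C" "y = \<Gamma> x' + c" "wbar \<bullet> y \<le> \<gamma>"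
    by (auto simp: upper_image_def lower_halfspace_def)
  then have "primal_feasible C X \<Gamma> wbar \<gamma> v (x', y - v)"
    by (simp add: primal_feasible_iff)
  then show "mnorm M (snd xz) \<le> mnorm M (y - v)"
    using opt by (simp add: xz)
qed

text \<open>After T the norm is Euclidean, and the variational inequality of a closest point
  applies. It is invoked on the image of the segment from v + z to y, a closed convex set.\<close>

lemma projection_normal:
  assumes "v + z \<in> A" "\<And>y. y \<in> A \<Longrightarrow> mnorm M z \<le> mnorm M (y - v)" "y \<in> A"
  shows "0 \<le> T z \<bullet> T (y - (v + z))"
proof -
  have seg: "closed_segment (v + z) y \<subseteq> A"
    using assms convex_A by (intro closed_segment_subset)
  have img: "closed_segment (T (v + z)) (T y) = T ` closed_segment (v + z) y"
    by (intro closed_segment_linear_image) simp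
  have "dist (T v) (T (v + z)) \<le> dist (T v) (T u)" if "u \<in> closed_segment (v + z) y" for u
  proof -
    have "mnorm M z \<le> mnorm M (u - v)"
      using that seg by (intro assms(2)) auto
    then show ?thesis
      by (simp add: dist_norm norm_minus_commute mnorm_eq_norm_sqrt[OF M]
          matrix_vector_mult_diff_distrib matrix_vector_right_distrib)
  qed
  then have "\<forall>w\<in>closed_segment (T (v + z)) (T y). dist (T v) (T (v + z)) \<le> dist (T v) w"
    by (simp add: img)
  then have "(T v - T (v + z)) \<bullet> (T y - T (v + z)) \<le> 0"
    by (intro any_closest_point_dot[of "closed_segment (T (v + z)) (T y)"]) auto
  then show ?thesis
    by (simp add: matrix_vector_right_distrib matrix_vector_mult_diff_distrib inner_simps)
qed

lemma inner_M: "(M *v y) \<bullet> z = T y \<bullet> T z"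
proof -
  have "(M *v y) \<bullet> z = T (T y) \<bullet> z"
    by (simp add: matrix_vector_mul_assoc matrix_sqrt(2)[OF M])
  then show ?thesis
    using matrix_sqrt(1)[OF M] by (simp add: sym_pos_def_alt)
qed

text \<open>The gradient a of the norm at z supports A at v + z. A multiplier l extends this bound
  from the slice to all of P, and w = a + l \<open>wbar\<close> is then bounded below on P, hence
  nonnegative on C. Since a . y <= \<open>mnorm M y\<close>, the Lagrangian at (w, l) never falls
  below the primal value.\<close>

lemma strong_duality:
  assumes z: "v + z \<in> A" "\<And>y. y \<in> A \<Longrightarrow> mnorm M z \<le> mnorm M (y - v)" "z \<noteq> 0"
  obtains w l where "w \<in> dual_cone C" "l \<ge> 0" "ereal (mnorm M z) \<le> dual_value M X \<Gamma> wbar \<gamma> v (w, l)"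
proof -
  define \<delta> where "\<delta> = mnorm M z"
  define a where "a = (1 / \<delta>) *\<^sub>R (M *v z)"
  define \<beta> where "\<beta> = a \<bullet> (v + z)"
  have Tz: "T z \<noteq> 0"
    using sym_pos_def_inj[OF matrix_sqrt(1)[OF M]] z(3) by (metis injD matrix_vector_mult_0_right)
  then have \<delta>: "\<delta> > 0" by (simp add: \<delta>_def mnorm_eq_norm_sqrt[OF M])
  have a_le: "a \<bullet> y \<le> mnorm M y" for y
    using norm_cauchy_schwarz[of "T z" "T y"] \<delta>
    by (simp add: a_def inner_M divide_le_eq mnorm_eq_norm_sqrt[OF M] \<delta>_def mult.commute)
  have az: "a \<bullet> z = \<delta>"
    using Tz by (simp add: a_def inner_M \<delta>_def mnorm_eq_norm_sqrt[OF M] dot_square_norm power2_eq_square)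
  have "\<beta> \<le> a \<bullet> y" if "y \<in> P" "wbar \<bullet> y \<le> \<gamma>" for y
  proof -
    have "0 \<le> a \<bullet> (y - (v + z))"
      using projection_normal[OF z(1,2), of y] that \<delta> by (simp add: a_def inner_M lower_halfspace_def)
    then show ?thesis by (simp add: \<beta>_def inner_diff_right)
  qed
  moreover obtain x0 where x0: "x0 \<in> X" using X(1) by blast
  ultimately obtain l where l: "l \<ge> 0" and le: "\<And>y. y \<in> P \<Longrightarrow> \<beta> \<le> a \<bullet> y + l * (wbar \<bullet> y - \<gamma>)"
    using halfspace_multiplier[OF convex_P, of wbar \<gamma> \<beta> a "\<Gamma> x0"] slater[OF x0] \<Gamma>_in_A[OF x0] by blast
  define w where "w = a + l *\<^sub>R wbar"
  have w: "\<beta> + l * \<gamma> \<le> w \<bullet> y" if "y \<in> P" for y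
    using le[OF that] by (simp add: w_def inner_simps algebra_simps)
  have "0 \<le> w \<bullet> c" if c: "c \<in> C" for c
  proof (rule ccontr)
    assume "\<not> 0 \<le> w \<bullet> c"
    then have neg: "w \<bullet> c < 0" by simp
    \<comment> \<open>Far enough along c that w undercuts its lower bound on P by at least
      1.\<close>
    define s where "s = max 0 ((\<beta> + l * \<gamma> - w \<bullet> \<Gamma> x0 - 1) / (w \<bullet> c))"
    have "\<Gamma> x0 + s *\<^sub>R c \<in> P"
      using x0 c cone_C(3)[of c s] by (auto simp: upper_image_def s_def)
    from w[OF this] have 1: "\<beta> + l * \<gamma> - w \<bullet> \<Gamma> x0 \<le> s * (w \<bullet> c)"
      by (simp add: inner_simps)
    have "s \<ge> (\<beta> + l * \<gamma> - w \<bullet> \<Gamma> x0 - 1) / (w \<bullet> c)" by (simp add: s_def)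
    then have "s * (w \<bullet> c) \<le> \<beta> + l * \<gamma> - w \<bullet> \<Gamma> x0 - 1"
      using neg by (simp add: neg_divide_le_eq)
    then show False using 1 by simp
  qed
  then have "w \<in> dual_cone C" by (simp add: dual_cone_def)
  moreover have "ereal \<delta> \<le> dual_value M X \<Gamma> wbar \<gamma> v (w, l)"
    unfolding dual_value_def prod.case
  proof (rule INF_greatest, clarify)
    fix x y assume x: "x \<in> X"
    have "\<beta> + l * \<gamma> \<le> w \<bullet> \<Gamma> x" using w \<Gamma>_in_A[OF x] by blast
    then have "\<delta> \<le> mnorm M y + w \<bullet> (\<Gamma> x - y - v) + l * (wbar \<bullet> (v + y) - \<gamma>)"
      using a_le[of y] az by (simp add: w_def \<beta>_def inner_simps algebra_simps)
    then show "ereal \<delta> \<le> ereal (mnorm M y + w \<bullet> (\<Gamma> x - y - v) + l * (wbar \<bullet> (v + y) - \<gamma>))"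
      by simp
  qed
  ultimately show ?thesis using that l by (simp add: \<delta>_def)
qed

text \<open>An optimal dual value is at least \<open>mnorm M z\<close>. Finiteness of the
  Lagrangian's infimum along rays gives a . y <= \<open>mnorm M y\<close>, and its value at a primal
  point gives \<open>mnorm M z\<close> <= a . z. So a is a subgradient of the norm at z, which is
  unique.\<close>

lemma dual_optimal_normal:
  assumes z: "v + z \<in> A" "\<And>y. y \<in> A \<Longrightarrow> mnorm M z \<le> mnorm M (y - v)" "z \<noteq> 0"
    and dual: "dual_optimal M C X \<Gamma> wbar \<gamma> v (w, l)"
  shows "w - l *\<^sub>R wbar = (1 / mnorm M z) *\<^sub>R (M *v z)"
proof -
  define a \<delta> where "a = w - l *\<^sub>R wbar" and "\<delta> = mnorm M z"
  have w: "w \<in> dual_cone C" and l: "l \<ge> 0"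
    using dual by (auto simp: dual_optimal_def is_arg_max_def)
  obtain w' l' where "w' \<in> dual_cone C" "l' \<ge> 0" "ereal \<delta> \<le> dual_value M X \<Gamma> wbar \<gamma> v (w', l')"
    using strong_duality[OF z] \<delta>_def by metis
  then have "ereal \<delta> \<le> dual_value M X \<Gamma> wbar \<gamma> v (w, l)"
    using dual by (force simp: dual_optimal_def is_arg_max_def not_less)
  then have le: "\<delta> \<le> mnorm M y + w \<bullet> (\<Gamma> x - y - v) + l * (wbar \<bullet> (v + y) - \<gamma>)" if "x \<in> X" for x y
    using that unfolding dual_value_def by (auto simp: le_INF_iff)
  have scale: "mnorm M (s *\<^sub>R y) = s * mnorm M y" if "s \<ge> 0" for s y
    using that by (simp add: mnorm_eq_norm_sqrt[OF M] matrix_vector_mult_scaleR)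
  obtain x0 where x0: "x0 \<in> X" using X(1) by blast
  \<comment> \<open>The part of the Lagrangian at x0 that does not depend on y: the Lagrangian
    equals \<open>mnorm M y\<close> - a . y + \<kappa>.\<close>
  define \<kappa> where "\<kappa> = w \<bullet> \<Gamma> x0 - a \<bullet> v - l * \<gamma>"
  have "a \<bullet> y \<le> mnorm M y" for y
  proof (rule ccontr)
    assume "\<not> ?thesis"
    then have neg: "mnorm M y - a \<bullet> y < 0" by simp
    define s where "s = max 0 ((\<delta> - \<kappa> - 1) / (mnorm M y - a \<bullet> y))"
    have "\<delta> \<le> mnorm M (s *\<^sub>R y) - a \<bullet> (s *\<^sub>R y) + \<kappa>"
      using le[OF x0, of "s *\<^sub>R y"] by (simp add: \<kappa>_def a_def inner_simps algebra_simps)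
    then have 1: "\<delta> - \<kappa> \<le> s * (mnorm M y - a \<bullet> y)"
      using scale[of s y] by (simp add: s_def algebra_simps)
    have "s \<ge> (\<delta> - \<kappa> - 1) / (mnorm M y - a \<bullet> y)" by (simp add: s_def)
    then have "s * (mnorm M y - a \<bullet> y) \<le> \<delta> - \<kappa> - 1"
      using neg by (simp add: neg_divide_le_eq)
    then show False using 1 by simp
  qed
  \<comment> \<open>The Lagrangian is evaluated at y = 0 and at the x with v + z in \<Gamma> x + C;
    the signs of w on C and of l do the rest.\<close>
  moreover have "\<delta> \<le> a \<bullet> z"
  proof -
    obtain x c where x: "x \<in> X" and c: "c \<in> C" "v + z = \<Gamma> x + c" and y: "wbar \<bullet> (v + z) \<le> \<gamma>"
      using z(1) by (auto simp: upper_image_def lower_halfspace_def)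
    have "0 \<le> w \<bullet> c" using w c by (simp add: dual_cone_def)
    then have "w \<bullet> \<Gamma> x \<le> w \<bullet> (v + z)" by (simp add: c(2) inner_simps)
    moreover have "l * (wbar \<bullet> (v + z)) \<le> l * \<gamma>" using y l by (rule mult_left_mono)
    moreover have "\<delta> \<le> w \<bullet> (\<Gamma> x - v) + l * (wbar \<bullet> v - \<gamma>)"
      using le[OF x, of 0] by (simp add: mnorm_def)
    ultimately show ?thesis
      by (simp add: a_def inner_simps algebra_simps)
  qed
  ultimately show ?thesis
    using mnorm_subgradient_unique[OF M, of a z] z(3) by (simp add: a_def \<delta>_def)
qed

end

section \<open>Boundedness of the slice and of the initial outer approximation\<close>

context slice_problem
begin

text \<open>Makes the real infimum in \<open>supporting_halfspace\<close> a genuine lower bound: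
  \<Gamma>(X) is compact, and w is nonnegative on C.\<close>

lemma bdd_below_dual:
  assumes "w \<in> dual_cone C"
  shows "bdd_below ((\<lambda>y. w \<bullet> y) ` A)"
proof -
  have "bdd_below ((\<lambda>x. w \<bullet> \<Gamma> x) ` X)"
    using X(2) \<Gamma>(1) by (intro bounded_imp_bdd_below compact_imp_bounded compact_continuous_image continuous_intros)
  then obtain m where m: "\<And>x. x \<in> X \<Longrightarrow> m \<le> w \<bullet> \<Gamma> x"
    by (auto simp: bdd_below_def)
  have "m \<le> w \<bullet> y" if y: "y \<in> A" for y
  proof -
    obtain x c where "x \<in> X" "c \<in> C" "y = \<Gamma> x + c"
      using y by (auto simp: upper_image_def)
    moreover from this have "0 \<le> w \<bullet> c"
      using assms by (simp add: dual_cone_def)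
    ultimately show ?thesis
      using m[of x] by (simp add: inner_add_right)
  qed
  then show ?thesis by (intro bdd_belowI2)
qed

lemma initial_approx_properties:
  assumes \<omega>: "\<And>j. j \<in> {1..I} \<Longrightarrow> \<omega> j \<in> dual_cone C"
    and hull: "convex_cone hull (\<omega> ` {1..I}) = dual_cone C"
  defines "A0 \<equiv> initial_approx \<omega> I A wbar \<gamma>"
  shows "A \<subseteq> A0" "convex A0" "compact A0"
proof -
  show "A \<subseteq> A0"
    using cINF_lower[OF bdd_below_dual[OF \<omega>]]
    by (auto simp: A0_def initial_approx_def supporting_halfspace_def)
  show "convex A0"
    unfolding A0_def initial_approx_def supporting_halfspace_def lower_halfspace_def
    by (intro convex_Int convex_INT convex_halfspace_le convex_halfspace_ge)
  \<comment> \<open>The directions bounded below on \<open>A0\<close> form a convex cone containing the generators, hence all of \<open>C\<^sup>+\<close>;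
    perturbing \<open>wbar\<close> inside \<open>C\<^sup>+\<close> then bounds \<open>A0\<close> in every direction.\<close>
  define W where "W = {w. \<exists>h. \<forall>y\<in>A0. h \<le> w \<bullet> y}"
  have "convex_cone W"
    unfolding convex_cone_iff
  proof (intro conjI ballI allI impI)
    show "0 \<in> W" by (auto simp: W_def)
    fix w assume w: "w \<in> W"
    then obtain h where h: "\<forall>y\<in>A0. h \<le> w \<bullet> y" by (auto simp: W_def)
    {
      fix w' assume "w' \<in> W"
      then obtain h' where "\<forall>y\<in>A0. h' \<le> w' \<bullet> y" by (auto simp: W_def)
      then have "\<forall>y\<in>A0. h + h' \<le> (w + w') \<bullet> y"
        using h by (auto simp: inner_simps intro: add_mono)
      then show "w + w' \<in> W" by (auto simp: W_def)
    next
      fix c :: real assume "0 \<le> c"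
      then have "\<forall>y\<in>A0. c * h \<le> (c *\<^sub>R w) \<bullet> y"
        using h by (auto intro: mult_left_mono)
      then show "c *\<^sub>R w \<in> W" by (auto simp: W_def)
    }
  qed
  moreover have "\<omega> ` {1..I} \<subseteq> W"
    by (auto simp: W_def A0_def initial_approx_def supporting_halfspace_def)
  ultimately have W: "dual_cone C \<subseteq> W"
    using hull hull_minimal by metis
  obtain e where e: "e > 0" "cball wbar e \<subseteq> dual_cone C"
    using wbar by (auto simp: mem_interior_cball)
  have "\<exists>h. \<forall>y\<in>A0. b \<bullet> y \<le> h" if "norm b \<le> 1" for b
  proof -
    have "wbar - e *\<^sub>R b \<in> cball wbar e"
      using e(1) that by (simp add: dist_norm)
    then have "wbar - e *\<^sub>R b \<in> W"
      using e(2) W by blast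
    then obtain h where h: "\<forall>y\<in>A0. h \<le> (wbar - e *\<^sub>R b) \<bullet> y"
      by (auto simp: W_def)
    have "b \<bullet> y \<le> (\<gamma> - h) / e" if y: "y \<in> A0" for y
    proof -
      have "wbar \<bullet> y \<le> \<gamma>" using y by (simp add: A0_def initial_approx_def lower_halfspace_def)
      moreover have "h \<le> (wbar - e *\<^sub>R b) \<bullet> y" using h y by blast
      ultimately show ?thesis using e(1) by (simp add: inner_simps pos_le_divide_eq mult.commute)
    qed
    then show ?thesis by blast
  qed
  then have ub: "bdd_above ((\<lambda>y. b \<bullet> y) ` A0)" if "norm b \<le> 1" for b
    using that by (fastforce simp: bdd_above_def)
  have "\<exists>h. \<forall>y\<in>A0. \<bar>y \<bullet> b\<bar> \<le> h" if "b \<in> Basis" for b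
  proof -
    have "norm b \<le> 1" "norm (- b) \<le> 1"
      using norm_Basis[OF that] by simp_all
    from ub[OF this(1)] ub[OF this(2)]
    obtain h h' where "\<forall>y\<in>A0. b \<bullet> y \<le> h" "\<forall>y\<in>A0. (- b) \<bullet> y \<le> h'"
      by (auto simp: bdd_above_def)
    then have "\<bar>y \<bullet> b\<bar> \<le> max h h'" if "y \<in> A0" for y
      using that by (fastforce simp: inner_commute abs_le_iff le_max_iff_disj)
    then show ?thesis by blast
  qed
  then obtain H where H: "\<And>b y. b \<in> Basis \<Longrightarrow> y \<in> A0 \<Longrightarrow> \<bar>y \<bullet> b\<bar> \<le> H b"
    by metis
  have "bounded A0"
  proof (rule boundedI)
    fix y assume "y \<in> A0"
    then show "norm y \<le> (\<Sum>b\<in>Basis. H b)"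
      using norm_le_l1[of y] sum_mono[of Basis "\<lambda>b. \<bar>y \<bullet> b\<bar>" H] H by force
  qed
  moreover have "closed A0"
    unfolding A0_def initial_approx_def supporting_halfspace_def lower_halfspace_def
    by (intro closed_Int closed_INT ballI closed_halfspace_le closed_halfspace_ge)
  ultimately show "compact A0" by (simp add: compact_eq_bounded_closed)
qed

end

subsection \<open>Runs of the algorithm\<close>

locale outer_approximation = slice_problem C X \<Gamma> wbar \<gamma> M
  for C :: "(real^'q) set" and X :: "(real^'n) set" and \<Gamma> wbar \<gamma> M +
  fixes \<omega> :: "nat \<Rightarrow> real^'q" and I :: nat
    and Ak :: "nat \<Rightarrow> (real^'q) set" and sol :: "nat \<Rightarrow> real^'q \<Rightarrow> (real^'n) \<times> (real^'q)"
    and vs ws :: "nat \<Rightarrow> real^'q" and ls :: "nat \<Rightarrow> real"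
  assumes \<omega>: "\<And>j. j \<in> {1..I} \<Longrightarrow> \<omega> j \<in> dual_cone C"
    and hull: "convex_cone hull (\<omega> ` {1..I}) = dual_cone C"
    and run: "outer_approx_run M C X \<Gamma> wbar \<gamma> \<omega> I A Ak sol vs ws ls"
begin

abbreviation zs where "zs k \<equiv> snd (sol k (vs k))"
abbreviation ys where "ys k \<equiv> vs k + zs k"

lemma zs_eq_0_imp:
  assumes "\<forall>i<k. zs i \<noteq> 0" "zs k = 0" "j > k"
  shows "Ak j = A"
  using run assms unfolding outer_approx_run_def Let_def by auto

text \<open>Data after the stopping iteration are arbitrary, so the zero at i0 may be accidental;
  the least zero is the actual stop.\<close>

lemma Ak_eq_A:
  assumes "zs i0 = 0" "i0 < k"
  shows "Ak k = A"
proof -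
  define i where "i = (LEAST i. zs i = 0)"
  have "zs i = 0" unfolding i_def using assms(1) by (rule LeastI)
  moreover have "i \<le> i0" unfolding i_def using assms(1) by (rule Least_le)
  moreover have "\<forall>j<i. zs j \<noteq> 0" unfolding i_def by (blast dest: not_less_Least)
  ultimately show ?thesis using assms(2) by (intro zs_eq_0_imp[of i]) auto
qed

lemma primal:
  assumes "\<forall>i<k. zs i \<noteq> 0" "v extreme_point_of Ak k"
  shows "primal_optimal M C X \<Gamma> wbar \<gamma> v (sol k v)"
  using run assms unfolding outer_approx_run_def by blast

lemma selected:
  assumes "\<forall>i<k. zs i \<noteq> 0"
  shows "vs k extreme_point_of Ak k"
    and "v extreme_point_of Ak k \<Longrightarrow> mnorm M (snd (sol k v)) \<le> mnorm M (zs k)"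
proof -
  have "is_arg_max (\<lambda>v. mnorm M (snd (sol k v))) (\<lambda>v. v extreme_point_of Ak k) (vs k)"
    using run assms unfolding outer_approx_run_def by blast
  then show "vs k extreme_point_of Ak k"
    and "v extreme_point_of Ak k \<Longrightarrow> mnorm M (snd (sol k v)) \<le> mnorm M (zs k)"
    by (auto simp: is_arg_max_def not_less)
qed

lemma ys_in_A: "\<forall>i<k. zs i \<noteq> 0 \<Longrightarrow> ys k \<in> A"
  and zs_le: "\<forall>i<k. zs i \<noteq> 0 \<Longrightarrow> y \<in> A \<Longrightarrow> mnorm M (zs k) \<le> mnorm M (y - vs k)"
  using primal_optimalD[OF primal[OF _ selected(1)]] by blast+

text \<open>Removes the dual solution from the recursion: its normal is a positive multiple of M z,
  so in T-coordinates the cut depends only on the projection.\<close>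

lemma Ak_Suc:
  assumes "\<forall>i\<le>k. zs i \<noteq> 0"
  shows "Ak (Suc k) = Ak k \<inter> {u. 0 \<le> T (zs k) \<bullet> T (u - ys k)}"
proof -
  have ns: "\<forall>i<k. zs i \<noteq> 0" "zs k \<noteq> 0" using assms by auto
  have dual: "dual_optimal M C X \<Gamma> wbar \<gamma> (vs k) (ws k, ls k)"
    and step: "Ak (Suc k) = Ak k \<inter> {u. (ws k - ls k *\<^sub>R wbar) \<bullet> u \<ge> (ws k - ls k *\<^sub>R wbar) \<bullet> ys k}"
    using run ns unfolding outer_approx_run_def Let_def by presburger+
  have n: "mnorm M (zs k) > 0"
    using ns(2) M by (simp add: mnorm_def sym_pos_def_def)
  have normal: "ws k - ls k *\<^sub>R wbar = (1 / mnorm M (zs k)) *\<^sub>R (M *v zs k)"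
    by (rule dual_optimal_normal[OF ys_in_A[OF ns(1)] _ ns(2) dual]) (rule zs_le[OF ns(1)])
  have "(ws k - ls k *\<^sub>R wbar) \<bullet> u \<ge> (ws k - ls k *\<^sub>R wbar) \<bullet> ys k \<longleftrightarrow> 0 \<le> T (zs k) \<bullet> T (u - ys k)" for u
  proof -
    have "(ws k - ls k *\<^sub>R wbar) \<bullet> (u - ys k) = (T (zs k) \<bullet> T (u - ys k)) / mnorm M (zs k)"
      unfolding normal by (simp add: inner_M)
    then have "0 \<le> (ws k - ls k *\<^sub>R wbar) \<bullet> (u - ys k) \<longleftrightarrow> 0 \<le> T (zs k) \<bullet> T (u - ys k)"
      using n by (simp add: zero_le_divide_iff)
    then show ?thesis by (simp only: inner_diff_right[of _ u] diff_ge_0_iff_ge)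
  qed
  then show ?thesis using step by auto
qed

lemma supporting:
  assumes "\<forall>i<k. zs i \<noteq> 0" "y \<in> A"
  shows "0 \<le> T (zs k) \<bullet> T (y - ys k)"
  using projection_normal[OF ys_in_A zs_le] assms by blast

lemma Ak_properties:
  assumes "\<forall>i<k. zs i \<noteq> 0"
  shows "A \<subseteq> Ak k \<and> convex (Ak k) \<and> compact (Ak k)"
  using assms
proof (induction k)
  case 0
  have "Ak 0 = initial_approx \<omega> I A wbar \<gamma>"
    using run by (simp add: outer_approx_run_def)
  then show ?case using initial_approx_properties[OF \<omega> hull] by simp
next
  case (Suc k)
  have eq: "Ak (Suc k) = Ak k \<inter> {u. 0 \<le> T (zs k) \<bullet> T (u - ys k)}"
    using Suc.prems by (intro Ak_Suc) auto
  have "{u. 0 \<le> T (zs k) \<bullet> T (u - ys k)} = {u. (M *v zs k) \<bullet> u \<ge> (M *v zs k) \<bullet> ys k}"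
    by (simp add: inner_M[symmetric] inner_diff_right)
  then have "convex {u. 0 \<le> T (zs k) \<bullet> T (u - ys k)}" "closed {u. 0 \<le> T (zs k) \<bullet> T (u - ys k)}"
    by (simp_all only: convex_halfspace_ge closed_halfspace_ge)
  moreover have "A \<subseteq> {u. 0 \<le> T (zs k) \<bullet> T (u - ys k)}"
    using supporting[of k] Suc.prems by auto
  ultimately show ?case
    using Suc eq by (auto intro: convex_Int compact_Int_closed)
qed

lemma Ak_antimono:
  assumes "i \<le> j" "\<forall>i<j. zs i \<noteq> 0"
  shows "Ak j \<subseteq> Ak i"
  using assms
proof (induction j rule: dec_induct)
  case (step n)
  then show ?case using Ak_Suc[of n] by auto
qed simp

lemma vs_in_Ak: "\<forall>i<k. zs i \<noteq> 0 \<Longrightarrow> vs k \<in> Ak k"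
  using selected(1) by (auto simp: extreme_point_of_def)

text \<open>The sum of A and the norm ball \<open>D\<close> is convex and contains every extreme
  point, because the selected vertex is the farthest one; by Minkowski's theorem it contains the
  compact convex set \<open>Ak k\<close>.\<close>

lemma Ak_near_A:
  assumes "\<forall>i<k. zs i \<noteq> 0" "u \<in> Ak k"
  shows "\<exists>a\<in>A. mnorm M (u - a) \<le> mnorm M (zs k)"
proof -
  define D where "D = {z. mnorm M z \<le> mnorm M (zs k)}"
  have "D = {z. T z \<in> cball 0 (mnorm M (zs k))}"
    by (auto simp: D_def mnorm_eq_norm_sqrt[OF M])
  then have "convex D"
    using convex_linear_vimage[of "\<lambda>z. T z" "cball 0 (mnorm M (zs k))"] by (simp add: vimage_def)
  then have conv: "convex (\<Union>a\<in>A. \<Union>z\<in>D. {a + z})"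
    by (intro convex_sums convex_A)
  have "{v. v extreme_point_of Ak k} \<subseteq> (\<Union>a\<in>A. \<Union>z\<in>D. {a + z})"
  proof clarify
    fix v assume v: "v extreme_point_of Ak k"
    define z where "z = snd (sol k v)"
    have "v + z \<in> A"
      using primal_optimalD(1)[OF primal[OF assms(1) v]] by (simp add: z_def)
    moreover have "mnorm M (- z) \<le> mnorm M (zs k)"
      using selected(2)[OF assms(1) v] by (simp add: z_def mnorm_eq_norm_sqrt[OF M] linear_neg[OF matrix_vector_mul_linear])
    moreover have "v = (v + z) + - z" by simp
    ultimately show "v \<in> (\<Union>a\<in>A. \<Union>z\<in>D. {a + z})"
      unfolding D_def by blast
  qed
  then have "convex hull {v. v extreme_point_of Ak k} \<subseteq> (\<Union>a\<in>A. \<Union>z\<in>D. {a + z})"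
    by (rule hull_minimal) (rule conv)
  moreover have "Ak k = convex hull {v. v extreme_point_of Ak k}"
    using Ak_properties[OF assms(1)] by (intro Krein_Milman_Minkowski) auto
  ultimately obtain a z where "a \<in> A" "z \<in> D" "u = a + z"
    using assms(2) by blast
  then show ?thesis unfolding D_def by force
qed

lemma mnorm_nonneg: "0 \<le> mnorm M y" and mnorm_0: "mnorm M 0 = 0"
  by (simp_all add: mnorm_eq_norm_sqrt[OF M])

lemma hausdorff_le:
  assumes "\<forall>i<k. zs i \<noteq> 0"
  shows "0 \<le> hausdorff (mnorm M) (Ak k) A" "hausdorff (mnorm M) (Ak k) A \<le> mnorm M (zs k)"
proof -
  have sub: "A \<subseteq> Ak k" using Ak_properties[OF assms] by blast
  note bounds = hausdorff_bounds[OF mnorm_nonneg mnorm_0 sub A_nonempty Ak_near_A[OF assms]]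
  show "0 \<le> hausdorff (mnorm M) (Ak k) A" "hausdorff (mnorm M) (Ak k) A \<le> mnorm M (zs k)"
    by (rule bounds, assumption)+
qed

lemma hausdorff_A: "hausdorff (mnorm M) A A = 0"
proof (rule antisym)
  have "\<exists>z\<in>A. mnorm M (y - z) \<le> 0" if "y \<in> A" for y
    using that by (intro bexI[of _ y]) (simp_all add: mnorm_0)
  note bounds = hausdorff_bounds[OF mnorm_nonneg mnorm_0 subset_refl A_nonempty this]
  show "hausdorff (mnorm M) A A \<le> 0" "0 \<le> hausdorff (mnorm M) A A"
    by (rule bounds, assumption)+
qed

lemma hausdorff_nonneg: "0 \<le> hausdorff (mnorm M) (Ak k) A"
proof (cases "\<forall>i<k. zs i \<noteq> 0")
  case True
  then show ?thesis by (rule hausdorff_le)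
next
  case False
  then obtain i where "i < k" "zs i = 0" by blast
  then show ?thesis by (simp add: Ak_eq_A[of i] hausdorff_A)
qed

lemma rate:
  assumes q: "CARD('q) \<ge> 2" and r: "r > 0" "(\<lambda>y. T y) ` A \<subseteq> cball c r" and \<epsilon>: "\<epsilon> > 0"
  defines "n \<equiv> real CARD('q)"
  shows "\<exists>K. \<forall>k\<ge>K. hausdorff (mnorm M) (Ak k) A
      \<le> (1 + \<epsilon>) * (16 * r * (n * unit_ball_vol n / unit_ball_vol (n - 1)) powr (2 / (n - 1)))
          * real k powr (2 / (1 - n))"
proof (cases "\<forall>k. zs k \<noteq> 0")
  case True
  define v p where "v k = T (vs k)" and "p k = T (ys k)" for k
  have vp: "v k - p k = - T (zs k)" for k
    by (simp add: v_def p_def matrix_vector_right_distrib)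
  have nvp: "norm (v k - p k) = mnorm M (zs k)" for k
    by (simp add: vp mnorm_eq_norm_sqrt[OF M])
  have cut: "(v i - p i) \<bullet> (v j - p i) \<le> 0" if "i < j" for i j
  proof -
    have "vs j \<in> Ak (Suc i)"
      using Ak_antimono[of "Suc i" j] vs_in_Ak[of j] True that by auto
    then have "0 \<le> T (zs i) \<bullet> T (vs j - ys i)"
      using Ak_Suc[of i] True by auto
    then show ?thesis
      by (simp add: vp) (simp add: v_def p_def matrix_vector_mult_diff_distrib)
  qed
  \<comment> \<open>The distance selected at step i bounds the distance to A on all of
    \<open>Ak i\<close>, and the later vertex j lies there.\<close>
  have mono: "norm (v j - p j) \<le> norm (v i - p i)" if ij: "i \<le> j" for i j
  proof -
    have "vs j \<in> Ak i" using Ak_antimono[OF ij] vs_in_Ak[of j] True by auto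
    then obtain a where a: "a \<in> A" "mnorm M (vs j - a) \<le> mnorm M (zs i)"
      using Ak_near_A[of i] True by blast
    have "mnorm M (zs j) \<le> mnorm M (a - vs j)" using zs_le[OF _ a(1)] True by blast
    also have "\<dots> = mnorm M (vs j - a)"
      by (simp add: mnorm_eq_norm_sqrt[OF M] matrix_vector_mult_diff_distrib norm_minus_commute)
    finally show ?thesis using a(2) by (simp add: nvp)
  qed
  have "v k \<noteq> p k" for k
    using sym_pos_def_inj[OF matrix_sqrt(1)[OF M]] True
    by (auto simp: v_def p_def dest!: injD)
  moreover have "(v j - p j) \<bullet> (y - p j) \<le> 0" if "y \<in> (\<lambda>y. T y) ` A" for j y
    using supporting[of j] True that by (auto simp: vp) (auto simp: p_def matrix_vector_mult_diff_distrib)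
  moreover have "p j \<in> (\<lambda>y. T y) ` A" for j
    using ys_in_A[of j] True by (auto simp: p_def)
  ultimately obtain K where K: "\<And>k. k \<ge> K \<Longrightarrow> norm (v k - p k)
      \<le> (1 + \<epsilon>) * (16 * r * (n * unit_ball_vol n / unit_ball_vol (n - 1)) powr (2 / (n - 1)))
          * real k powr (2 / (1 - n))"
    using cutting_scheme_rate[of "(\<lambda>y. T y) ` A" c r p v \<epsilon>] q r cut mono \<epsilon> by (auto simp: n_def)
  have "hausdorff (mnorm M) (Ak k) A \<le> norm (v k - p k)" for k
    using hausdorff_le(2)[of k] True by (simp add: nvp)
  then show ?thesis using K by (meson order_trans)
next
  case False
  then obtain i where "zs i = 0" by blast
  then have "hausdorff (mnorm M) (Ak k) A = 0" if "k > i" for k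
    using Ak_eq_A[of i k] that by (simp add: hausdorff_A)
  moreover have "0 \<le> (1 + \<epsilon>) * (16 * r * (n * unit_ball_vol n / unit_ball_vol (n - 1)) powr (2 / (n - 1)))
          * real k powr (2 / (1 - n))" for k
    using r \<epsilon> by simp
  ultimately show ?thesis by (metis Suc_le_eq)
qed

end

section \<open>The circumradius and the final rate\<close>

lemma circumradius_pos:
  assumes "a \<in> B" "b \<in> B" "a \<noteq> b" "bounded B"
  shows "0 < circumradius B"
proof -
  have "dist a b / 2 \<le> circumradius B"
    unfolding circumradius_def
  proof (rule cInf_greatest)
    obtain c r where "B \<subseteq> cball c r"
      using \<open>bounded B\<close> bounded_subset_cball by blast
    moreover from this have "0 \<le> r"
      using assms(1) by (metis mem_cball subsetD zero_le_dist order_trans)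
    ultimately show "{r. 0 \<le> r \<and> (\<exists>c. B \<subseteq> cball c r)} \<noteq> {}" by blast
  next
    fix r assume "r \<in> {r. 0 \<le> r \<and> (\<exists>c. B \<subseteq> cball c r)}"
    then obtain c where "B \<subseteq> cball c r" by blast
    then have "dist c a \<le> r" "dist c b \<le> r" using assms by auto
    then show "dist a b / 2 \<le> r"
      using dist_triangle3[of a b c] by simp
  qed
  moreover have "0 < dist a b" using assms by simp
  ultimately show ?thesis by linarith
qed

text \<open>A strictly larger radius is exceeded by no infimum argument: some admissible radius lies
  below r, so attainment is not at issue. The slack is charged to \<epsilon>.\<close>

lemma circumradius_ball:
  assumes "circumradius B < r" "bounded B" "B \<noteq> {}"
  obtains c where "B \<subseteq> cball c r"
proof -
  obtain c0 r0 where c0: "B \<subseteq> cball c0 r0"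
    using \<open>bounded B\<close> bounded_subset_cball by blast
  then have "0 \<le> r0"
    using \<open>B \<noteq> {}\<close> by (metis cball_empty linorder_not_less subset_empty)
  then have "{r. 0 \<le> r \<and> (\<exists>c. B \<subseteq> cball c r)} \<noteq> {}" using c0 by blast
  from cInf_lessD[OF this assms(1)[unfolded circumradius_def]]
  obtain r' c where "r' < r" "B \<subseteq> cball c r'" by blast
  then have "B \<subseteq> cball c r" by force
  then show ?thesis using that by blast
qed

context outer_approximation
begin

lemma bounded_image_A: "bounded ((\<lambda>y. T y) ` A)"
proof -
  have "bounded A"
    using initial_approx_properties[OF \<omega> hull] bounded_subset compact_imp_bounded by blast
  then show ?thesis
    by (rule bounded_linear_image) (rule matrix_vector_mul_bounded_linear)
qed

lemma circumradius_image_A_pos: "0 < circumradius ((\<lambda>y. T y) ` A)"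
proof -
  obtain x where x: "x \<in> X" using X(1) by blast
  obtain c where c: "c \<in> C" "c \<noteq> 0"
    using C cone_C(2) by (auto simp: ordering_cone_def)
  \<comment> \<open>Small enough that the second point stays in the half-space; the + 1 keeps the
    denominator positive.\<close>
  define s where "s = (\<gamma> - wbar \<bullet> \<Gamma> x) / (\<bar>wbar \<bullet> c\<bar> + 1)"
  have s: "s > 0" using slater[OF x] by (simp add: s_def)
  have "s * (wbar \<bullet> c) \<le> s * (\<bar>wbar \<bullet> c\<bar> + 1)"
    using s by (intro mult_left_mono) auto
  also have "\<dots> = \<gamma> - wbar \<bullet> \<Gamma> x" by (simp add: s_def)
  finally have "wbar \<bullet> (\<Gamma> x + s *\<^sub>R c) \<le> \<gamma>" by (simp add: inner_simps)
  moreover have "\<Gamma> x + s *\<^sub>R c \<in> P"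
    using x cone_C(3)[OF c(1), of s] s by (auto simp: upper_image_def)
  ultimately have "\<Gamma> x + s *\<^sub>R c \<in> A" by (simp add: lower_halfspace_def)
  moreover have "T (\<Gamma> x) \<noteq> T (\<Gamma> x + s *\<^sub>R c)"
    using injD[OF sym_pos_def_inj[OF matrix_sqrt(1)[OF M]]] s c(2) by force
  ultimately show ?thesis
    using \<Gamma>_in_A[OF x] bounded_image_A by (intro circumradius_pos) auto
qed

lemma rate_lambda_bar:
  assumes q: "CARD('q) \<ge> 2" and \<epsilon>: "\<epsilon> > 0"
  shows "\<exists>K. \<forall>k\<ge>K. hausdorff (mnorm M) (Ak k) A
    \<le> (1 + \<epsilon>) * lambda_bar ((\<lambda>y. T y) ` A) * real k powr (2 / (1 - real CARD('q)))"
proof -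
  \<comment> \<open>Two factors 1 + e share 1 + \<epsilon>: one enlarges the circumradius to the
    radius of an enclosing ball, the other is the loss in \<open>rate\<close>.\<close>
  define e where "e = sqrt (1 + \<epsilon>) - 1"
  have e: "e > 0" "(1 + e) * (1 + e) = 1 + \<epsilon>" using \<epsilon> by (simp_all add: e_def)
  let ?R = "circumradius ((\<lambda>y. T y) ` A)"
  have "?R < (1 + e) * ?R" using circumradius_image_A_pos e(1) by simp
  then obtain c where c: "(\<lambda>y. T y) ` A \<subseteq> cball c ((1 + e) * ?R)"
    by (rule circumradius_ball) (use bounded_image_A A_nonempty in blast)+
  have pos: "0 < (1 + e) * ?R" using circumradius_image_A_pos e(1) by simp
  have scale: "(1 + e) * (16 * ((1 + e) * ?R) * Q) = (1 + \<epsilon>) * (16 * ?R * Q)" for Q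
    unfolding e(2)[symmetric] by (simp add: mult_ac)
  show ?thesis
    using rate[OF q pos c e(1)] unfolding scale lambda_bar_def .
qed

lemma bigo_rate:
  assumes q: "CARD('q) \<ge> 2"
  shows "(\<lambda>k. hausdorff (mnorm M) (Ak k) A) \<in> O(\<lambda>k. real k powr (2 / (1 - real CARD('q))))"
proof -
  obtain K where "\<And>k. k \<ge> K \<Longrightarrow> hausdorff (mnorm M) (Ak k) A
      \<le> (1 + 1) * lambda_bar ((\<lambda>y. T y) ` A) * real k powr (2 / (1 - real CARD('q)))"
    using rate_lambda_bar[OF q, of 1] by auto
  then show ?thesis
    using hausdorff_nonneg
    by (intro bigoI[where c = "(1 + 1) * lambda_bar ((\<lambda>y. T y) ` A)"])
      (auto simp: eventually_sequentially)
qed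

end

theorem theorem5:
  fixes C :: "(real^'q) set" and X :: "(real^'n) set" and \<Gamma> :: "real^'n \<Rightarrow> real^'q"
    and M :: "real^'q^'q" and wbar :: "real^'q" and \<alpha> \<gamma> :: real
    and P A Atilde :: "(real^'q) set"
    and \<omega> :: "nat \<Rightarrow> real^'q" and I :: nat
    and Ak :: "nat \<Rightarrow> (real^'q) set" and sol :: "nat \<Rightarrow> real^'q \<Rightarrow> (real^'n) \<times> (real^'q)"
    and vs ws :: "nat \<Rightarrow> real^'q" and ls :: "nat \<Rightarrow> real"
  assumes q: "CARD('q) \<ge> 2"
    and C: "ordering_cone C"
    and X: "X \<noteq> {}" "compact X" "convex X" "interior X \<noteq> {}"
    and \<Gamma>: "continuous_on X \<Gamma>" "cone_convex_on C X \<Gamma>"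
    and P: "P = upper_image C X \<Gamma>"
    and wbar: "wbar \<in> interior (dual_cone C)"
    and \<gamma>: "\<gamma> = (SUP x\<in>X. wbar \<bullet> \<Gamma> x) + \<alpha>" "\<alpha> > 0" "\<Gamma> ` X \<subseteq> interior (lower_halfspace wbar \<gamma>)"
    and A: "A = P \<inter> lower_halfspace wbar \<gamma>"
    and M: "sym_pos_def M"
    and \<omega>: "\<And>j. j \<in> {1..I} \<Longrightarrow> \<omega> j \<in> dual_cone C - {0}"
      "convex_cone hull (\<omega> ` {1..I}) = dual_cone C"
    and run: "outer_approx_run M C X \<Gamma> wbar \<gamma> \<omega> I A Ak sol vs ws ls"
    and Atilde: "Atilde = (\<lambda>y. matrix_sqrt M *v y) ` A"
  shows "Atilde = (\<lambda>y. matrix_sqrt M *v y) ` P \<inter> (\<lambda>y. matrix_sqrt M *v y) ` lower_halfspace wbar \<gamma>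
    \<and> (\<forall>\<epsilon>>0. \<exists>K. \<forall>k\<ge>K. hausdorff (mnorm M) (Ak k) A
         \<le> (1 + \<epsilon>) * lambda_bar Atilde * real k powr (2 / (1 - real CARD('q))))
    \<and> (\<lambda>k. hausdorff (mnorm M) (Ak k) A) \<in> O(\<lambda>k. real k powr (2 / (1 - real CARD('q))))"
proof -
  \<comment> \<open>Only for a bounded family is the real \<open>SUP\<close> in \<gamma> an upper
    bound; \<alpha> > 0 then makes the inequality strict.\<close>
  have "bdd_above ((\<lambda>x. wbar \<bullet> \<Gamma> x) ` X)"
    using X(2) \<Gamma>(1) by (intro bounded_imp_bdd_above compact_imp_bounded compact_continuous_image continuous_intros)
  then have slater: "wbar \<bullet> \<Gamma> x < \<gamma>" if "x \<in> X" for x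
    using cSUP_upper[OF that] \<gamma>(1,2) by fastforce
  interpret outer_approximation C X \<Gamma> wbar \<gamma> M \<omega> I Ak sol vs ws ls
    using C X \<Gamma> wbar slater M \<omega> run by unfold_locales (auto simp: A P)
  have "Atilde = (\<lambda>y. matrix_sqrt M *v y) ` P \<inter> (\<lambda>y. matrix_sqrt M *v y) ` lower_halfspace wbar \<gamma>"
    unfolding Atilde A by (rule image_Int) (rule sym_pos_def_inj[OF matrix_sqrt(1)[OF M]])
  moreover have "\<forall>\<epsilon>>0. \<exists>K. \<forall>k\<ge>K. hausdorff (mnorm M) (Ak k) A
      \<le> (1 + \<epsilon>) * lambda_bar Atilde * real k powr (2 / (1 - real CARD('q)))"
    unfolding Atilde A P using rate_lambda_bar[OF q] by blast
  moreover have "(\<lambda>k. hausdorff (mnorm M) (Ak k) A) \<in> O(\<lambda>k. real k powr (2 / (1 - real CARD('q))))"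
    unfolding A P by (rule bigo_rate[OF q])
  ultimately show ?thesis by blast
qed

end
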